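(* If $f : X \to Y$ is a flat map (resp. flat cover) of locally finite type fans, then $f$ is open (resp. open and surjective) on underlying topological spaces.
   Context: Monoids are commutative, written additively, with $0$. $P^*$ is the group of units of $P$. A monoid map $h : Q \to P$ is local if $h^{-1}(P^* ) = Q^*$. A module over a monoid $P$ is a set $M$ with an action $P \times M \to M$, $(p,m) \mapsto p+m$, satisfying $p+(q+m) = (p+q)+m$ and $0+m=m$. A $P$-module is free if it has a basis, i.e. a subset $S \subseteq M$ such that every $m \in M$ is $p+s$ for a unique pair $(p,s) \in P \times S$; it is flat if it is a filtered direct limit of free $P$-modules. A monoid map $h : Q \to P$ is flat if $P$ is a flat $Q$-module via $q+p := h(q)+p$. A locally monoidal space is a topological space $X$ with a sheaf of monoids $\mathcal{M}_X$; a morphism $f : X \to Y$ is a continuous map together with a map $f^{-1}\mathcal{M}_Y \to \mathcal{M}_X$ whose stalks $f_x : \mathcal{M}_{Y,f(x)} \to \mathcal{M}_{X,x}$ are all local. A face of $P$ is a submonoid $F$ such that $p+p' \in F$ implies $p,p' \in F$. $\operatorname{Spec} P$ is the set of faces of $P$, with the topology having basis $U_p = \{F : p \in F\}$ ($p \in P$), and with the structure sheaf $\mathcal{M}_P$ determined by $\mathcal{M}_P(U_p) = P[-p]$ (localization making $p$ invertible); its stalk at $F$ is $F^{-1}P$. A fan is a locally monoidal space locally isomorphic to $\operatorname{Spec} P$ for monoids $P$; it is locally finite type if it has an open cover by fans $\operatorname{Spec} P$ with $P$ finitely generated. Maps of fans are morphisms of locally monoidal spaces. A map of fans $f : X \to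 Y$ is flat if $f_x : \mathcal{M}_{Y,f(x)} \to \mathcal{M}_{X,x}$ is a flat monoid map for every $x \in X$; it is a flat cover if it is flat and surjective. *)

theory Defs
  imports "HOL-Analysis.Analysis" "HOL-Algebra.Group"
begin

text \<open>
  All monoids are commutative and are represented by monoid records of HOL-Algebra, hence
  written multiplicatively: \<open>p \<otimes> q\<close> is $p + q$, \<open>\<one>\<close> is $0$, \<open>Units P\<close> is $P^*$.
\<close>

section \<open>Monoids\<close>

text \<open>In contrast to \<^const>\<open>hom\<close>, the neutral element has to be preserved.\<close>

definition monoid_hom :: "'q monoid \<Rightarrow> 'p monoid \<Rightarrow> ('q \<Rightarrow> 'p) set" where
  "monoid_hom Q P = {h \<in> hom Q P. h \<one>\<^bsub>Q\<^esub> = \<one>\<^bsub>P\<^esub>}"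

definition local_hom :: "'q monoid \<Rightarrow> 'p monoid \<Rightarrow> ('q \<Rightarrow> 'p) \<Rightarrow> bool" where
  "local_hom Q P h \<longleftrightarrow> h \<in> monoid_hom Q P \<and> {q \<in> carrier Q. h q \<in> Units P} = Units Q"

definition finitely_generated_monoid :: "'p monoid \<Rightarrow> bool" where
  "finitely_generated_monoid P \<longleftrightarrow>
    (\<exists>A. finite A \<and> A \<subseteq> carrier P \<and> \<Inter>{H. submonoid H P \<and> A \<subseteq> H} = carrier P)"

definition is_face :: "'p monoid \<Rightarrow> 'p set \<Rightarrow> bool" where
  "is_face P F \<longleftrightarrow> submonoid F P \<and>
    (\<forall>p\<in>carrier P. \<forall>p'\<in>carrier P. p \<otimes>\<^bsub>P\<^esub> p' \<in> F \<longrightarrow> p \<in> F \<and> p' \<in> F)"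

text \<open>
  The localization $S^{-1}P$ at a submonoid $S$; \<open>loc_frac P S a s\<close> is the class of $a - s$.
  The union over all representatives is the common value, as in \<^theory>\<open>HOL.Equiv_Relations\<close>.
\<close>

definition loc_frac :: "'p monoid \<Rightarrow> 'p set \<Rightarrow> 'p \<Rightarrow> 'p \<Rightarrow> ('p \<times> 'p) set" where
  "loc_frac P S a s = {(b, t). b \<in> carrier P \<and> t \<in> S \<and>
     (\<exists>u\<in>S. u \<otimes>\<^bsub>P\<^esub> (a \<otimes>\<^bsub>P\<^esub> t) = u \<otimes>\<^bsub>P\<^esub> (b \<otimes>\<^bsub>P\<^esub> s))}"

definition localization :: "'p monoid \<Rightarrow> 'p set \<Rightarrow> ('p \<times> 'p) set monoid" where
  "localization P S =
    \<lparr>carrier = {loc_frac P S a s |a s. a \<in> carrier P \<and> s \<in> S},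
     mult = (\<lambda>A B. \<Union>(a, s)\<in>A. \<Union>(b, t)\<in>B. loc_frac P S (a \<otimes>\<^bsub>P\<^esub> b) (s \<otimes>\<^bsub>P\<^esub> t)),
     one = loc_frac P S \<one>\<^bsub>P\<^esub> \<one>\<^bsub>P\<^esub>\<rparr>"

text \<open>
  The canonical map $S^{-1}P \to T^{-1}P$, $a - s \mapsto a - s$, for submonoids $S$, $T$ such that
  the elements of $S$ are invertible in $T^{-1}P$.
\<close>

definition localization_map ::
  "'p monoid \<Rightarrow> 'p set \<Rightarrow> 'p set \<Rightarrow> ('p \<times> 'p) set \<Rightarrow> ('p \<times> 'p) set" where
  "localization_map P S T A = (\<Union>(a, s)\<in>A.
     loc_frac P T a \<one>\<^bsub>P\<^esub> \<otimes>\<^bsub>localization P T\<^esub> inv\<^bsub>localization P T\<^esub> (loc_frac P T s \<one>\<^bsub>P\<^esub>))"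

definition powers :: "'p monoid \<Rightarrow> 'p \<Rightarrow> 'p set" where
  "powers P p = range (\<lambda>n::nat. p [^]\<^bsub>P\<^esub> n)"

section \<open>Modules over a monoid and flatness\<close>

record ('q, 'm) mmodule = "'m partial_object" +
  act :: "'q \<Rightarrow> 'm \<Rightarrow> 'm"

definition is_mmodule :: "'q monoid \<Rightarrow> ('q, 'm) mmodule \<Rightarrow> bool" where
  "is_mmodule Q M \<longleftrightarrow>
    (\<forall>q\<in>carrier Q. \<forall>m\<in>carrier M. act M q m \<in> carrier M) \<and>
    (\<forall>p\<in>carrier Q. \<forall>q\<in>carrier Q. \<forall>m\<in>carrier M. act M p (act M q m) = act M (p \<otimes>\<^bsub>Q\<^esub> q) m) \<and>
    (\<forall>m\<in>carrier M. act M \<one>\<^bsub>Q\<^esub> m = m)"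

definition mmodule_hom ::
  "'q monoid \<Rightarrow> ('q, 'm) mmodule \<Rightarrow> ('q, 'n) mmodule \<Rightarrow> ('m \<Rightarrow> 'n) set" where
  "mmodule_hom Q M N =
    {g \<in> carrier M \<rightarrow> carrier N. \<forall>q\<in>carrier Q. \<forall>m\<in>carrier M. g (act M q m) = act N q (g m)}"

definition mmodule_isomorphic ::
  "'q monoid \<Rightarrow> ('q, 'm) mmodule \<Rightarrow> ('q, 'n) mmodule \<Rightarrow> bool" where
  "mmodule_isomorphic Q M N \<longleftrightarrow>
    (\<exists>g\<in>mmodule_hom Q M N. bij_betw g (carrier M) (carrier N))"

definition free_mmodule :: "'q monoid \<Rightarrow> ('q, 'm) mmodule \<Rightarrow> bool" where
  "free_mmodule Q M \<longleftrightarrow> is_mmodule Q M \<and>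
    (\<exists>S\<subseteq>carrier M. \<forall>m\<in>carrier M. \<exists>!(q, s). q \<in> carrier Q \<and> s \<in> S \<and> m = act M q s)"

text \<open>
  A small category. \<open>cmp J i j k u v\<close> is the composite $u \circ v$ of \<open>v \<in> Hom J i j\<close> and
  \<open>u \<in> Hom J j k\<close>; hom-sets of different pairs of objects need not be disjoint.
\<close>

record ('i, 'a) cat =
  Ob :: "'i set"
  Hom :: "'i \<Rightarrow> 'i \<Rightarrow> 'a set"
  idn :: "'i \<Rightarrow> 'a"
  cmp :: "'i \<Rightarrow> 'i \<Rightarrow> 'i \<Rightarrow> 'a \<Rightarrow> 'a \<Rightarrow> 'a"

definition is_cat :: "('i, 'a) cat \<Rightarrow> bool" where
  "is_cat J \<longleftrightarrow>
    (\<forall>i\<in>Ob J. idn J i \<in> Hom J i i) \<and>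
    (\<forall>i\<in>Ob J. \<forall>j\<in>Ob J. \<forall>k\<in>Ob J. \<forall>v\<in>Hom J i j. \<forall>u\<in>Hom J j k. cmp J i j k u v \<in> Hom J i k) \<and>
    (\<forall>i\<in>Ob J. \<forall>j\<in>Ob J. \<forall>u\<in>Hom J i j.
       cmp J i i j u (idn J i) = u \<and> cmp J i j j (idn J j) u = u) \<and>
    (\<forall>i\<in>Ob J. \<forall>j\<in>Ob J. \<forall>k\<in>Ob J. \<forall>l\<in>Ob J.
       \<forall>w\<in>Hom J i j. \<forall>v\<in>Hom J j k. \<forall>u\<in>Hom J k l.
         cmp J i j l (cmp J j k l u v) w = cmp J i k l u (cmp J i j k v w))"

definition filtered_cat :: "('i, 'a) cat \<Rightarrow> bool" where
  "filtered_cat J \<longleftrightarrow> is_cat J \<and> Ob J \<noteq> {} \<and>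
    (\<forall>i\<in>Ob J. \<forall>j\<in>Ob J. \<exists>k\<in>Ob J. Hom J i k \<noteq> {} \<and> Hom J j k \<noteq> {}) \<and>
    (\<forall>i\<in>Ob J. \<forall>j\<in>Ob J. \<forall>u\<in>Hom J i j. \<forall>v\<in>Hom J i j.
       \<exists>k\<in>Ob J. \<exists>w\<in>Hom J j k. cmp J i j k w u = cmp J i j k w v)"

text \<open>A functor from \<open>J\<close> to \<open>Q\<close>-modules: \<open>D i\<close> is the module at \<open>i\<close>, and \<open>t i j u\<close> is the transition
  map along \<open>u \<in> Hom J i j\<close>.\<close>

definition mmodule_diagram :: "'q monoid \<Rightarrow> ('i, 'a) cat \<Rightarrow>
    ('i \<Rightarrow> ('q, 'm) mmodule) \<Rightarrow> ('i \<Rightarrow> 'i \<Rightarrow> 'a \<Rightarrow> 'm \<Rightarrow> 'm) \<Rightarrow> bool" where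
  "mmodule_diagram Q J D t \<longleftrightarrow>
    (\<forall>i\<in>Ob J. is_mmodule Q (D i)) \<and>
    (\<forall>i\<in>Ob J. \<forall>j\<in>Ob J. \<forall>u\<in>Hom J i j. t i j u \<in> mmodule_hom Q (D i) (D j)) \<and>
    (\<forall>i\<in>Ob J. \<forall>x\<in>carrier (D i). t i i (idn J i) x = x) \<and>
    (\<forall>i\<in>Ob J. \<forall>j\<in>Ob J. \<forall>k\<in>Ob J. \<forall>v\<in>Hom J i j. \<forall>u\<in>Hom J j k. \<forall>x\<in>carrier (D i).
       t i k (cmp J i j k u v) x = t j k u (t i j v x))"

definition direct_limit_rel :: "('i, 'a) cat \<Rightarrow>
    ('i \<Rightarrow> ('q, 'm) mmodule) \<Rightarrow> ('i \<Rightarrow> 'i \<Rightarrow> 'a \<Rightarrow> 'm \<Rightarrow> 'm) \<Rightarrow> (('i \<times> 'm) \<times> ('i \<times> 'm)) set" where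
  "direct_limit_rel J D t = {((i, x), (j, y)).
     i \<in> Ob J \<and> x \<in> carrier (D i) \<and> j \<in> Ob J \<and> y \<in> carrier (D j) \<and>
     (\<exists>k\<in>Ob J. \<exists>u\<in>Hom J i k. \<exists>v\<in>Hom J j k. t i k u x = t j k v y)}"

definition direct_limit :: "('i, 'a) cat \<Rightarrow>
    ('i \<Rightarrow> ('q, 'm) mmodule) \<Rightarrow> ('i \<Rightarrow> 'i \<Rightarrow> 'a \<Rightarrow> 'm \<Rightarrow> 'm) \<Rightarrow> ('q, ('i \<times> 'm) set) mmodule" where
  "direct_limit J D t =
    \<lparr>carrier = (SIGMA i:Ob J. carrier (D i)) // direct_limit_rel J D t,
     act = (\<lambda>q A. \<Union>(i, x)\<in>A. direct_limit_rel J D t `` {(i, act (D i) q x)})\<rparr>"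

text \<open>
  HOL has no existential quantification over types, so flatness carries as type arguments the
  types \<open>'i\<close>, \<open>'a\<close>, \<open>'c\<close> from which the index category (objects, arrows) and the elements of the
  free modules are drawn. A hypothesis of flatness that is polymorphic in these types covers
  filtered direct limits of arbitrary size.
\<close>

definition flat_mmodule :: "'i itself \<Rightarrow> 'a itself \<Rightarrow> 'c itself \<Rightarrow>
    'q monoid \<Rightarrow> ('q, 'm) mmodule \<Rightarrow> bool" where
  "flat_mmodule TI TA TC Q M \<longleftrightarrow> is_mmodule Q M \<and>
    (\<exists>(J :: ('i, 'a) cat) (D :: 'i \<Rightarrow> ('q, 'c) mmodule) t.
       filtered_cat J \<and> mmodule_diagram Q J D t \<and> (\<forall>i\<in>Ob J. free_mmodule Q (D i)) \<and>
       mmodule_isomorphic Q (direct_limit J D t) M)"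

definition flat_hom :: "'i itself \<Rightarrow> 'a itself \<Rightarrow> 'c itself \<Rightarrow>
    'q monoid \<Rightarrow> 'p monoid \<Rightarrow> ('q \<Rightarrow> 'p) \<Rightarrow> bool" where
  "flat_hom TI TA TC Q P h \<longleftrightarrow> h \<in> monoid_hom Q P \<and>
    flat_mmodule TI TA TC Q \<lparr>carrier = carrier P, act = (\<lambda>q p. h q \<otimes>\<^bsub>P\<^esub> p)\<rparr>"

section \<open>Locally monoidal spaces\<close>

text \<open>\<open>Res X U V\<close> is the restriction from \<open>Sec X U\<close> to \<open>Sec X V\<close> for open sets \<open>V \<subseteq> U\<close>.\<close>

record ('x, 'm) mspace =
  Top :: "'x topology"
  Sec :: "'x set \<Rightarrow> 'm monoid"
  Res :: "'x set \<Rightarrow> 'x set \<Rightarrow> 'm \<Rightarrow> 'm"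

definition presheaf_of_monoids :: "('x, 'm) mspace \<Rightarrow> bool" where
  "presheaf_of_monoids X \<longleftrightarrow>
    (\<forall>U. openin (Top X) U \<longrightarrow> comm_monoid (Sec X U)) \<and>
    (\<forall>U V. openin (Top X) U \<and> openin (Top X) V \<and> V \<subseteq> U \<longrightarrow>
       Res X U V \<in> monoid_hom (Sec X U) (Sec X V)) \<and>
    (\<forall>U. openin (Top X) U \<longrightarrow> (\<forall>s\<in>carrier (Sec X U). Res X U U s = s)) \<and>
    (\<forall>U V W. openin (Top X) U \<and> openin (Top X) V \<and> openin (Top X) W \<and> W \<subseteq> V \<and> V \<subseteq> U \<longrightarrow>
       (\<forall>s\<in>carrier (Sec X U). Res X V W (Res X U V s) = Res X U W s))"

definition locally_monoidal_space :: "('x, 'm) mspace \<Rightarrow> bool" where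
  "locally_monoidal_space X \<longleftrightarrow> presheaf_of_monoids X \<and>
    (\<forall>\<U> \<sigma>. (\<forall>U\<in>\<U>. openin (Top X) U) \<and> (\<forall>U\<in>\<U>. \<sigma> U \<in> carrier (Sec X U)) \<and>
       (\<forall>U\<in>\<U>. \<forall>V\<in>\<U>. Res X U (U \<inter> V) (\<sigma> U) = Res X V (U \<inter> V) (\<sigma> V)) \<longrightarrow>
       (\<exists>!s. s \<in> carrier (Sec X (\<Union>\<U>)) \<and> (\<forall>U\<in>\<U>. Res X (\<Union>\<U>) U s = \<sigma> U)))"

definition germ :: "('x, 'm) mspace \<Rightarrow> 'x \<Rightarrow> 'x set \<Rightarrow> 'm \<Rightarrow> ('x set \<times> 'm) set" where
  "germ X x U s = {(V, t). openin (Top X) V \<and> x \<in> V \<and> t \<in> carrier (Sec X V) \<and>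
     (\<exists>W. openin (Top X) W \<and> x \<in> W \<and> W \<subseteq> U \<inter> V \<and> Res X U W s = Res X V W t)}"

definition stalk :: "('x, 'm) mspace \<Rightarrow> 'x \<Rightarrow> ('x set \<times> 'm) set monoid" where
  "stalk X x =
    \<lparr>carrier = {germ X x U s |U s. openin (Top X) U \<and> x \<in> U \<and> s \<in> carrier (Sec X U)},
     mult = (\<lambda>A B. \<Union>(U, s)\<in>A. \<Union>(V, t)\<in>B.
       germ X x (U \<inter> V) (Res X U (U \<inter> V) s \<otimes>\<^bsub>Sec X (U \<inter> V)\<^esub> Res X V (U \<inter> V) t)),
     one = germ X x (topspace (Top X)) \<one>\<^bsub>Sec X (topspace (Top X))\<^esub>\<rparr>"

definition preim :: "('x, 'm) mspace \<Rightarrow> ('x \<Rightarrow> 'y) \<Rightarrow> 'y set \<Rightarrow> 'x set" where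
  "preim X f V = {x \<in> topspace (Top X). f x \<in> V}"

text \<open>
  A map $f^{-1}\mathcal M_Y \to \mathcal M_X$ is given through the adjunction as a map
  $\mathcal M_Y \to f_* \mathcal M_X$, with components
  \<open>\<phi> V : Sec Y V \<rightarrow> Sec X (preim X f V)\<close>. Under the identification
  $(f^{-1}\mathcal M_Y)_x = \mathcal M_{Y,f(x)}$, its map on stalks is \<open>stalk_map X f \<phi> x\<close>.
\<close>

definition stalk_map :: "('x, 'm) mspace \<Rightarrow> ('x \<Rightarrow> 'y) \<Rightarrow> ('y set \<Rightarrow> 'n \<Rightarrow> 'm) \<Rightarrow> 'x \<Rightarrow>
    ('y set \<times> 'n) set \<Rightarrow> ('x set \<times> 'm) set" where
  "stalk_map X f \<phi> x A = (\<Union>(V, t)\<in>A. germ X x (preim X f V) (\<phi> V t))"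

definition mspace_morphism :: "('x, 'm) mspace \<Rightarrow> ('y, 'n) mspace \<Rightarrow>
    ('x \<Rightarrow> 'y) \<Rightarrow> ('y set \<Rightarrow> 'n \<Rightarrow> 'm) \<Rightarrow> bool" where
  "mspace_morphism X Y f \<phi> \<longleftrightarrow>
    locally_monoidal_space X \<and> locally_monoidal_space Y \<and>
    continuous_map (Top X) (Top Y) f \<and>
    (\<forall>V. openin (Top Y) V \<longrightarrow> \<phi> V \<in> monoid_hom (Sec Y V) (Sec X (preim X f V))) \<and>
    (\<forall>V W. openin (Top Y) V \<and> openin (Top Y) W \<and> W \<subseteq> V \<longrightarrow>
       (\<forall>t\<in>carrier (Sec Y V). \<phi> W (Res Y V W t) = Res X (preim X f V) (preim X f W) (\<phi> V t))) \<and>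
    (\<forall>x\<in>topspace (Top X). local_hom (stalk Y (f x)) (stalk X x) (stalk_map X f \<phi> x))"

definition mspace_isomorphic :: "('x, 'm) mspace \<Rightarrow> ('y, 'n) mspace \<Rightarrow> bool" where
  "mspace_isomorphic X Y \<longleftrightarrow> (\<exists>f \<phi> g \<psi>.
     mspace_morphism X Y f \<phi> \<and> mspace_morphism Y X g \<psi> \<and>
     (\<forall>x\<in>topspace (Top X). g (f x) = x) \<and> (\<forall>y\<in>topspace (Top Y). f (g y) = y) \<and>
     (\<forall>U. openin (Top X) U \<longrightarrow> (\<forall>s\<in>carrier (Sec X U). \<phi> (preim Y g U) (\<psi> U s) = s)) \<and>
     (\<forall>V. openin (Top Y) V \<longrightarrow> (\<forall>t\<in>carrier (Sec Y V). \<psi> (preim X f V) (\<phi> V t) = t)))"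

text \<open>The restriction of \<open>X\<close> to an open subset \<open>U\<close>, with the same sections over open subsets of
  \<open>U\<close>.\<close>

definition open_subspace :: "('x, 'm) mspace \<Rightarrow> 'x set \<Rightarrow> ('x, 'm) mspace" where
  "open_subspace X U = X\<lparr>Top := subtopology (Top X) U\<rparr>"

section \<open>Spectra and fans\<close>

definition faces :: "'p monoid \<Rightarrow> 'p set set" where
  "faces P = {F. is_face P F}"

definition basic_open :: "'p monoid \<Rightarrow> 'p \<Rightarrow> 'p set set" where
  "basic_open P p = {F \<in> faces P. p \<in> F}"

text \<open>
  The basic open sets are closed under finite intersection, so they form a basis of the topology
  which they generate. The structure sheaf is the sheaf determined by its values
  $P[-p]$ on the basic open sets: a section over \<open>U\<close> is a family of elements of $P[-p]$, one
  for each basic open \<open>U\<^sub>p \<subseteq> U\<close>, that is compatible with the localization maps.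
\<close>

definition basic_index :: "'p monoid \<Rightarrow> 'p set set \<Rightarrow> 'p set" where
  "basic_index P U = {p \<in> carrier P. basic_open P p \<subseteq> U}"

definition localize_at :: "'p monoid \<Rightarrow> 'p \<Rightarrow> ('p \<times> 'p) set monoid" where
  "localize_at P p = localization P (powers P p)"

definition Spec_sections ::
  "'p monoid \<Rightarrow> 'p set set \<Rightarrow> ('p \<Rightarrow> ('p \<times> 'p) set) monoid" where
  "Spec_sections P U =
    \<lparr>carrier = {\<sigma> \<in> \<Pi>\<^sub>E p\<in>basic_index P U. carrier (localize_at P p).
       \<forall>p\<in>basic_index P U. \<forall>q\<in>carrier P. basic_open P q \<subseteq> basic_open P p \<longrightarrow>
         \<sigma> q = localization_map P (powers P p) (powers P q) (\<sigma> p)},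
     mult = (\<lambda>\<sigma> \<tau>. \<lambda>p\<in>basic_index P U. \<sigma> p \<otimes>\<^bsub>localize_at P p\<^esub> \<tau> p),
     one = (\<lambda>p\<in>basic_index P U. \<one>\<^bsub>localize_at P p\<^esub>)\<rparr>"

definition Spec :: "'p monoid \<Rightarrow> ('p set, 'p \<Rightarrow> ('p \<times> 'p) set) mspace" where
  "Spec P =
    \<lparr>Top = topology_generated_by (basic_open P ` carrier P),
     Sec = Spec_sections P,
     Res = (\<lambda>U V \<sigma>. restrict \<sigma> (basic_index P V))\<rparr>"

text \<open>
  It is no restriction that the monoids \<open>P\<close> below live on the type \<open>'m\<close> of sections of \<open>X\<close>: if an
  open subspace \<open>U\<close> of \<open>X\<close> is isomorphic to \<open>Spec P\<close>, then \<open>P\<close> is isomorphic to \<open>Sec X U\<close>.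
\<close>

definition fan :: "('x, 'm) mspace \<Rightarrow> bool" where
  "fan X \<longleftrightarrow> locally_monoidal_space X \<and>
    (\<forall>x\<in>topspace (Top X). \<exists>U. openin (Top X) U \<and> x \<in> U \<and>
       (\<exists>P :: 'm monoid. comm_monoid P \<and> mspace_isomorphic (open_subspace X U) (Spec P)))"

definition locally_finite_type_fan :: "('x, 'm) mspace \<Rightarrow> bool" where
  "locally_finite_type_fan X \<longleftrightarrow> fan X \<and>
    (\<exists>\<U>. (\<forall>U\<in>\<U>. openin (Top X) U) \<and> \<Union>\<U> = topspace (Top X) \<and>
       (\<forall>U\<in>\<U>. \<exists>P :: 'm monoid. comm_monoid P \<and> finitely_generated_monoid P \<and>
          mspace_isomorphic (open_subspace X U) (Spec P)))"

text \<open>As in the definition of flat modules, the type arguments bound the size of the direct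
  limits.\<close>

definition flat_map :: "'i itself \<Rightarrow> 'a itself \<Rightarrow> 'c itself \<Rightarrow>
    ('x, 'm) mspace \<Rightarrow> ('y, 'n) mspace \<Rightarrow> ('x \<Rightarrow> 'y) \<Rightarrow> ('y set \<Rightarrow> 'n \<Rightarrow> 'm) \<Rightarrow> bool" where
  "flat_map TI TA TC X Y f \<phi> \<longleftrightarrow> mspace_morphism X Y f \<phi> \<and>
    (\<forall>x\<in>topspace (Top X).
       flat_hom TI TA TC (stalk Y (f x)) (stalk X x) (stalk_map X f \<phi> x))"

definition flat_cover :: "'i itself \<Rightarrow> 'a itself \<Rightarrow> 'c itself \<Rightarrow>
    ('x, 'm) mspace \<Rightarrow> ('y, 'n) mspace \<Rightarrow> ('x \<Rightarrow> 'y) \<Rightarrow> ('y set \<Rightarrow> 'n \<Rightarrow> 'm) \<Rightarrow> bool" where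
  "flat_cover TI TA TC X Y f \<phi> \<longleftrightarrow> flat_map TI TA TC X Y f \<phi> \<and>
    f ` topspace (Top X) = topspace (Top Y)"

end

theory Submission
  imports Defs
begin

text \<open>
  Sending a generization $x'$ of $x$ to the germs at $x$ that become invertible at $x'$ identifies
  the generizations of $x$ with the faces of the stalk $\mathcal M_{X,x}$, and in a locally finite
  type fan they form an open set. So openness of $f$ says that every face $G$ of
  $Q = \mathcal M_{Y,f(x)}$ is $h^{-1}(F)$ for some face $F$ of $P = \mathcal M_{X,x}$, where
  $h = f_x$. Take for $F$ the face generated by $h(G)$. If $h(q) + p = h(g)$ with $g \in G$, apply
  the equational criterion for flatness to $q + p = g + 0$ in the $Q$-module $P$: there are
  $b, b' \in Q$ and $n \in P$ with $q + b = g + b'$, $p = h(b) + n$ and $0 = h(b') + n$. As $h$ is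
  local, $b'$ is a unit, so $q + b \in G$ and $q \in G$.
\<close>

section \<open>Flatness\<close>

text \<open>The passage between faces and points takes place in charts. If an open set is isomorphic
  to the spectrum of \<open>P\<close>, its points are the faces of \<open>P\<close>, generizations
  are larger faces, and each germ becomes the germ of an element of \<open>P\<close> after
  multiplication by a unit; so a face of the stalk is determined by its preimage in
  \<open>P\<close>. Finite generation makes the set of larger faces open, because a face is
  determined by the generators that it contains. Open sets are stable under generization, so the
  lifting of generizations makes the image of an open set a neighbourhood of each of its points.
  Stalks, localizations and direct limits are explicit quotients whose operations are unions over
  representatives; for each of them it has to be shown that the union collapses to the value at one
  representative. The equational criterion is read off from whichever filtered limit is given, so
  the argument is the same for all types from which the limits are drawn.\<close>

lemma mmodule_hom_closed:
    "g \<in> mmodule_hom Q M N \<Longrightarrow> m \<in> carrier M \<Longrightarrow> g m \<in> carrier N"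
  and mmodule_hom_act:
    "g \<in> mmodule_hom Q M N \<Longrightarrow> q \<in> carrier Q \<Longrightarrow> m \<in> carrier M \<Longrightarrow>
      g (act M q m) = act N q (g m)"
  by (auto simp: mmodule_hom_def)

lemma mmodule_diagram_hom:
  "mmodule_diagram Q J D t \<Longrightarrow> i \<in> Ob J \<Longrightarrow> j \<in> Ob J \<Longrightarrow> u \<in> Hom J i j \<Longrightarrow>
    t i j u \<in> mmodule_hom Q (D i) (D j)"
  by (simp add: mmodule_diagram_def)

lemma filtered_cat_coequalize:
  assumes "filtered_cat J" "i \<in> Ob J" "j \<in> Ob J" "u \<in> Hom J i j" "v \<in> Hom J i j"
  shows "\<exists>k\<in>Ob J. \<exists>w\<in>Hom J j k. cmp J i j k w u = cmp J i j k w v"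
  using assms by (simp add: filtered_cat_def)

text \<open>Transitivity rests on filteredness. The stages at which \<open>x\<close> meets
  \<open>y\<close> and \<open>y\<close> meets \<open>z\<close> have a common bound \<open>m\<close>,
  but the two resulting arrows from \<open>j\<close> to \<open>m\<close> may differ; an arrow
  \<open>w\<close> that equalizes them makes the two equations composable.\<close>

lemma equiv_direct_limit_rel:
  assumes J: "filtered_cat J" and D: "mmodule_diagram Q J D t"
  shows "equiv (SIGMA i:Ob J. carrier (D i)) (direct_limit_rel J D t)"
proof (rule equivI)
  have idn: "idn J i \<in> Hom J i i" if "i \<in> Ob J" for i
    using J that by (auto simp: filtered_cat_def is_cat_def)
  have cmp: "cmp J i j k u v \<in> Hom J i k"
    if "i \<in> Ob J" "j \<in> Ob J" "k \<in> Ob J" "v \<in> Hom J i j" "u \<in> Hom J j k" for i j k u v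
    using J that by (auto simp: filtered_cat_def is_cat_def)
  have t_cmp: "t i k (cmp J i j k u v) x = t j k u (t i j v x)"
    if "i \<in> Ob J" "j \<in> Ob J" "k \<in> Ob J" "v \<in> Hom J i j" "u \<in> Hom J j k" "x \<in> carrier (D i)"
    for i j k u v x
    using D that by (simp add: mmodule_diagram_def)
  have t_closed: "t i j u x \<in> carrier (D j)"
    if "i \<in> Ob J" "j \<in> Ob J" "u \<in> Hom J i j" "x \<in> carrier (D i)" for i j u x
    by (rule mmodule_hom_closed[OF mmodule_diagram_hom[OF D that(1-3)] that(4)])
  show "direct_limit_rel J D t \<subseteq> (SIGMA i:Ob J. carrier (D i)) \<times> (SIGMA i:Ob J. carrier (D i))"
    by (auto simp: direct_limit_rel_def)
  show "refl_on (SIGMA i:Ob J. carrier (D i)) (direct_limit_rel J D t)"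
    unfolding refl_on_def direct_limit_rel_def using idn by blast
  show "sym (direct_limit_rel J D t)"
  proof (rule symI, clarsimp simp only: direct_limit_rel_def mem_Collect_eq case_prod_conv)
    fix i x j y k u v
    assume "k \<in> Ob J" "u \<in> Hom J i k" "v \<in> Hom J j k" "t i k u x = t j k v y"
    then show "\<exists>k\<in>Ob J. \<exists>u\<in>Hom J j k. \<exists>v\<in>Hom J i k. t j k u y = t i k v x"
      by metis
  qed
  show "trans (direct_limit_rel J D t)"
  proof (rule transI, clarsimp simp only: direct_limit_rel_def mem_Collect_eq case_prod_conv)
    fix i x j y k u v l z k' u' v'
    assume ij: "i \<in> Ob J" "x \<in> carrier (D i)" "j \<in> Ob J" "y \<in> carrier (D j)"
        "l \<in> Ob J" "z \<in> carrier (D l)"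
      and k: "k \<in> Ob J" "u \<in> Hom J i k" "v \<in> Hom J j k" "t i k u x = t j k v y"
      and k': "k' \<in> Ob J" "u' \<in> Hom J j k'" "v' \<in> Hom J l k'" "t j k' u' y = t l k' v' z"
    obtain m a b where m: "m \<in> Ob J" "a \<in> Hom J k m" "b \<in> Hom J k' m"
      using J k k' unfolding filtered_cat_def by blast
    have "cmp J j k m a v \<in> Hom J j m" "cmp J j k' m b u' \<in> Hom J j m"
      by (rule cmp; fact)+
    then obtain n w where n: "n \<in> Ob J" "w \<in> Hom J m n"
      "cmp J j m n w (cmp J j k m a v) = cmp J j m n w (cmp J j k' m b u')"
      using filtered_cat_coequalize[OF J ij(3) m(1)] by meson
    have "t i n (cmp J i m n w (cmp J i k m a u)) x = t m n w (t k m a (t i k u x))"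
      using ij k m n cmp t_cmp by simp
    also have "\<dots> = t j n (cmp J j m n w (cmp J j k m a v)) y"
      using ij k m n(1,2) cmp t_cmp by simp
    also have "\<dots> = t m n w (t k' m b (t j k' u' y))"
      unfolding n(3) using ij k' m n(1,2) cmp t_cmp by simp
    also have "\<dots> = t l n (cmp J l m n w (cmp J l k' m b v')) z"
      using ij k' m n(1,2) cmp t_cmp by simp
    finally have "t i n (cmp J i m n w (cmp J i k m a u)) x =
      t l n (cmp J l m n w (cmp J l k' m b v')) z" .
    moreover have "cmp J i m n w (cmp J i k m a u) \<in> Hom J i n"
      using ij k m n(1,2) cmp by simp
    moreover have "cmp J l m n w (cmp J l k' m b v') \<in> Hom J l n"
      using ij k' m n(1,2) cmp by simp
    ultimately show "\<exists>k\<in>Ob J. \<exists>u\<in>Hom J i k. \<exists>v\<in>Hom J l k. t i k u x = t l k v z"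
      using n(1) by metis
  qed
qed

section \<open>The equational criterion for flatness\<close>

text \<open>Both elements are multiples of basis elements \<open>s\<close> and \<open>s'\<close>,
  and \<open>act M q m\<close> is a multiple of each. Uniqueness of its expansion gives
  \<open>s = s'\<close> together with the equation between the coefficients, so \<open>s\<close>
  serves as \<open>n\<close>.\<close>

lemma free_mmodule_equation:
  assumes free: "free_mmodule Q M" and Q: "comm_monoid Q"
    and q: "q \<in> carrier Q" "q' \<in> carrier Q" and m: "m \<in> carrier M" "m' \<in> carrier M"
    and eq: "act M q m = act M q' m'"
  shows "\<exists>b\<in>carrier Q. \<exists>b'\<in>carrier Q. \<exists>n\<in>carrier M.
    q \<otimes>\<^bsub>Q\<^esub> b = q' \<otimes>\<^bsub>Q\<^esub> b' \<and> m = act M b n \<and> m' = act M b' n"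
proof -
  interpret comm_monoid Q by (rule Q)
  note free = free_mmodule_def[THEN iffD1, OF free]
  have M: "is_mmodule Q M"
    by (rule conjunct1[OF free])
  obtain S where S: "S \<subseteq> carrier M"
    "\<forall>m\<in>carrier M. \<exists>!(q, s). q \<in> carrier Q \<and> s \<in> S \<and> m = act M q s"
    using conjunct2[OF free] by (elim exE conjE)
  have basis: "\<exists>q\<in>carrier Q. \<exists>s\<in>S. m = act M q s \<and> (\<forall>q'\<in>carrier Q. \<forall>s'\<in>S. m = act M q' s' \<longrightarrow> q' = q \<and> s' = s)"
    if "m \<in> carrier M" for m
    using bspec[OF S(2) that] by (elim ex1E) (clarsimp, blast)
  obtain b s where b: "b \<in> carrier Q" "s \<in> S" "m = act M b s"
    using basis[OF m(1)] by blast
  obtain b' s' where b': "b' \<in> carrier Q" "s' \<in> S" "m' = act M b' s'"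
    using basis[OF m(2)] by blast
  have "act M q m = act M (q \<otimes>\<^bsub>Q\<^esub> b) s" "act M q m = act M (q' \<otimes>\<^bsub>Q\<^esub> b') s'"
    "act M q m \<in> carrier M"
    using M q b b' m S(1) eq by (auto simp: is_mmodule_def)
  moreover have "q \<otimes>\<^bsub>Q\<^esub> b \<in> carrier Q" "q' \<otimes>\<^bsub>Q\<^esub> b' \<in> carrier Q"
    using q b b' by simp_all
  ultimately have "q \<otimes>\<^bsub>Q\<^esub> b = q' \<otimes>\<^bsub>Q\<^esub> b'" "s = s'"
    using basis b(2) b'(2) by metis+
  then show ?thesis
    using b b' S(1) by auto
qed

text \<open>The equational criterion: a relation in a flat module is already realized in a free module
  of the direct limit, where both elements are multiples of one basis element.\<close>

lemma flat_mmodule_equation: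
  fixes TI :: "'i itself" and TA :: "'a itself" and TC :: "'c itself"
    and Q :: "'q monoid" and M :: "('q, 'm) mmodule"
  assumes flat: "flat_mmodule TI TA TC Q M" and Q: "comm_monoid Q"
    and q: "q \<in> carrier Q" "q' \<in> carrier Q" and m: "m \<in> carrier M" "m' \<in> carrier M"
    and eq: "act M q m = act M q' m'"
  shows "\<exists>b\<in>carrier Q. \<exists>b'\<in>carrier Q. \<exists>n\<in>carrier M.
    q \<otimes>\<^bsub>Q\<^esub> b = q' \<otimes>\<^bsub>Q\<^esub> b' \<and> m = act M b n \<and> m' = act M b' n"
proof -
  obtain J :: "('i, 'a) cat" and D :: "'i \<Rightarrow> ('q, 'c) mmodule" and t g where J: "filtered_cat J" and D: "mmodule_diagram Q J D t"
    and free: "\<And>i. i \<in> Ob J \<Longrightarrow> free_mmodule Q (D i)"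
    and g: "g \<in> mmodule_hom Q (direct_limit J D t) M"
      "bij_betw g (carrier (direct_limit J D t)) (carrier M)"
    using flat unfolding flat_mmodule_def mmodule_isomorphic_def by blast
  define R where "R = direct_limit_rel J D t"
  have equiv: "equiv (SIGMA i:Ob J. carrier (D i)) R"
    unfolding R_def by (rule equiv_direct_limit_rel[OF J D])
  have lim: "carrier (direct_limit J D t) = (SIGMA i:Ob J. carrier (D i)) // R"
    by (simp add: direct_limit_def R_def)
  have t_closed: "t i j u x \<in> carrier (D j)"
    if "i \<in> Ob J" "j \<in> Ob J" "u \<in> Hom J i j" "x \<in> carrier (D i)" for i j u x
    by (rule mmodule_hom_closed[OF mmodule_diagram_hom[OF D that(1-3)] that(4)])
  have t_act: "t i j u (act (D i) q x) = act (D j) q (t i j u x)"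
    if "i \<in> Ob J" "j \<in> Ob J" "u \<in> Hom J i j" "q \<in> carrier Q" "x \<in> carrier (D i)" for i j u q x
    by (rule mmodule_hom_act[OF mmodule_diagram_hom[OF D that(1-3)] that(4,5)])
  have act_closed: "act (D i) q x \<in> carrier (D i)"
    if "i \<in> Ob J" "q \<in> carrier Q" "x \<in> carrier (D i)" for i q x
    using D that by (simp add: mmodule_diagram_def is_mmodule_def)
  \<comment> \<open>Transition maps commute with the action, so related representatives give the
    same class and the union in the definition of the action collapses.\<close>
  have act_cls: "act (direct_limit J D t) q (R `` {(i, x)}) = R `` {(i, act (D i) q x)}"
    if ix: "i \<in> Ob J" "x \<in> carrier (D i)" and q: "q \<in> carrier Q" for q i x
  proof -
    have act_eq: "R `` {(i, act (D i) q x)} = R `` {(j, act (D j) q y)}"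
      if "((i, x), (j, y)) \<in> R" for i x j y
    proof -
      have "((i, act (D i) q x), (j, act (D j) q y)) \<in> R"
        using that q unfolding R_def direct_limit_rel_def
        by clarsimp (metis act_closed t_act)
      then show ?thesis
        by (rule equiv_class_eq[OF equiv])
    qed
    have "(\<lambda>(i, x). R `` {(i, act (D i) q x)}) respects R"
      using act_eq[of "fst a" "snd a" "fst b" "snd b" for a b]
      by (simp add: Equiv_Relations.congruent_def split_beta)
    from UN_equiv_class[OF equiv this, of "(i, x)"] show ?thesis
      using ix by (simp add: direct_limit_def R_def[symmetric])
  qed
  \<comment> \<open>The element of \<open>M\<close> represented by \<open>x\<close> at stage
    \<open>i\<close>; relations in \<open>M\<close> can then be handled at a stage, without mention
    of classes.\<close>
  define e where "e i x = g (R `` {(i, x)})" for i x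
  have cls: "R `` {(i, x)} \<in> carrier (direct_limit J D t)"
    if "i \<in> Ob J" "x \<in> carrier (D i)" for i x
    unfolding lim using that by (auto intro: quotientI)
  have e_closed: "e i x \<in> carrier M" if "i \<in> Ob J" "x \<in> carrier (D i)" for i x
    using g(2) cls[OF that] unfolding e_def bij_betw_def by blast
  have e_act: "e i (act (D i) q x) = act M q (e i x)"
    if "i \<in> Ob J" "x \<in> carrier (D i)" "q \<in> carrier Q" for i q x
    using g(1) cls[OF that(1,2)] that unfolding e_def mmodule_hom_def by (simp flip: act_cls)
  have e_eq: "e i x = e j y \<longleftrightarrow> ((i, x), (j, y)) \<in> R"
    if "i \<in> Ob J" "x \<in> carrier (D i)" "j \<in> Ob J" "y \<in> carrier (D j)" for i j x y
  proof -
    have "e i x = e j y \<longleftrightarrow> R `` {(i, x)} = R `` {(j, y)}"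
      using bij_betw_imp_inj_on[OF g(2)] cls that unfolding e_def by (simp add: inj_on_eq_iff)
    also have "\<dots> \<longleftrightarrow> ((i, x), (j, y)) \<in> R"
      using eq_equiv_class_iff[OF equiv] that by auto
    finally show ?thesis .
  qed
  have e_surj: "\<exists>i\<in>Ob J. \<exists>x\<in>carrier (D i). n = e i x" if n: "n \<in> carrier M" for n
  proof -
    obtain A where "A \<in> carrier (direct_limit J D t)" "n = g A"
      using g(2) n unfolding bij_betw_def by blast
    moreover from this(1) obtain i x where "i \<in> Ob J" "x \<in> carrier (D i)" "A = R `` {(i, x)}"
      unfolding lim by (auto simp: quotient_def)
    ultimately show ?thesis
      unfolding e_def by blast
  qed
  have e_t: "e j (t i j u x) = e i x"
    if ij: "i \<in> Ob J" "j \<in> Ob J" "u \<in> Hom J i j" "x \<in> carrier (D i)" for i j u x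
  proof -
    have "idn J j \<in> Hom J j j" "t j j (idn J j) (t i j u x) = t i j u x"
      using J D t_closed[OF ij] ij by (auto simp: filtered_cat_def is_cat_def mmodule_diagram_def)
    then have "((j, t i j u x), (i, x)) \<in> R"
      using ij t_closed[OF ij] unfolding R_def direct_limit_rel_def by auto
    then show ?thesis
      using e_eq ij t_closed[OF ij] by blast
  qed
  obtain i x where x: "i \<in> Ob J" "x \<in> carrier (D i)" "m = e i x"
    using e_surj m by blast
  obtain j y where y: "j \<in> Ob J" "y \<in> carrier (D j)" "m' = e j y"
    using e_surj m by blast
  have "e i (act (D i) q x) = e j (act (D j) q' y)"
    using e_act x y q eq by simp
  then have "((i, act (D i) q x), (j, act (D j) q' y)) \<in> R"
    using e_eq act_closed x y q by blast
  \<comment> \<open>Equality in the limit is witnessed at one stage \<open>k\<close>, where freeness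
    applies; \<open>e k\<close> carries the solution back to \<open>M\<close>.\<close>
  then obtain k u v where k: "k \<in> Ob J" "u \<in> Hom J i k" "v \<in> Hom J j k"
    "t i k u (act (D i) q x) = t j k v (act (D j) q' y)"
    unfolding R_def direct_limit_rel_def by blast
  then have "act (D k) q (t i k u x) = act (D k) q' (t j k v y)"
    using t_act x y q by simp
  then obtain b b' n where b: "b \<in> carrier Q" "b' \<in> carrier Q" "n \<in> carrier (D k)"
    "q \<otimes>\<^bsub>Q\<^esub> b = q' \<otimes>\<^bsub>Q\<^esub> b'" "t i k u x = act (D k) b n" "t j k v y = act (D k) b' n"
    using free_mmodule_equation[OF free[OF k(1)] Q q
        t_closed[OF x(1) k(1,2) x(2)] t_closed[OF y(1) k(1,3) y(2)]] by blast
  have "m = e k (t i k u x)" "m' = e k (t j k v y)"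
    using k(1-3) x y by (simp_all add: e_t)
  then have "m = act M b (e k n)" "m' = act M b' (e k n)"
    using b k(1) by (simp_all add: e_act)
  moreover have "e k n \<in> carrier M"
    using e_closed b k(1) by simp
  ultimately show ?thesis
    using b(1,2,4) by blast
qed

section \<open>Faces and their lifting along flat local homomorphisms\<close>

lemma is_face_submonoid: "is_face P F \<Longrightarrow> submonoid F P"
  by (rule is_face_def[THEN iffD1, THEN conjunct1])

lemmas is_face_closed = submonoid.mem_carrier[OF is_face_submonoid]
  and is_face_one = submonoid.one_closed[OF is_face_submonoid]

text \<open>As an equivalence, the two closure conditions become one rewrite rule: membership in a
  face is multiplicative, with conjunction as the product of truth values.\<close>

lemma is_face_mult:
  assumes "is_face P F" "p \<in> carrier P" "q \<in> carrier P"
  shows "p \<otimes>\<^bsub>P\<^esub> q \<in> F \<longleftrightarrow> p \<in> F \<and> q \<in> F"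
proof
  have factors: "\<forall>p\<in>carrier P. \<forall>q\<in>carrier P. p \<otimes>\<^bsub>P\<^esub> q \<in> F \<longrightarrow> p \<in> F \<and> q \<in> F"
    by (rule is_face_def[THEN iffD1, OF assms(1), THEN conjunct2])
  show "p \<in> F \<and> q \<in> F" if "p \<otimes>\<^bsub>P\<^esub> q \<in> F"
    by (rule factors[rule_format, OF assms(2,3) that])
  show "p \<in> F \<and> q \<in> F \<Longrightarrow> p \<otimes>\<^bsub>P\<^esub> q \<in> F"
    using submonoid.m_closed[OF is_face_submonoid[OF assms(1)]] by blast
qed

lemma is_faceI:
  assumes "F \<subseteq> carrier P" "\<one>\<^bsub>P\<^esub> \<in> F"
    "\<And>p q. p \<in> carrier P \<Longrightarrow> q \<in> carrier P \<Longrightarrow> p \<otimes>\<^bsub>P\<^esub> q \<in> F \<longleftrightarrow> p \<in> F \<and> q \<in> F"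
  shows "is_face P F"
  unfolding is_face_def
proof (intro conjI ballI impI submonoid.intro)
  show "p \<otimes>\<^bsub>P\<^esub> q \<in> F" if "p \<in> F" "q \<in> F" for p q
    using assms(3)[of p q] assms(1) that by auto
qed (use assms in auto)

lemma is_face_Units:
  assumes F: "is_face P F" and p: "p \<in> Units P"
  shows "p \<in> F"
proof -
  obtain q where "p \<in> carrier P" "q \<in> carrier P" "p \<otimes>\<^bsub>P\<^esub> q = \<one>\<^bsub>P\<^esub>"
    using p by (auto simp: Units_def)
  then show ?thesis
    using is_face_mult[OF F, of p q] is_face_one[OF F] by simp
qed

lemma flat_local_hom_lift_face:
  assumes Q: "comm_monoid Q" and P: "comm_monoid P"
    and flat: "flat_hom TI TA TC Q P h" and loc: "local_hom Q P h" and G: "is_face Q G"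
  shows "\<exists>F. is_face P F \<and> (\<forall>q\<in>carrier Q. h q \<in> F \<longleftrightarrow> q \<in> G)"
proof -
  interpret Q: comm_monoid Q by (rule Q)
  interpret P: comm_monoid P by (rule P)
  have h[simp]: "\<And>q. q \<in> carrier Q \<Longrightarrow> h q \<in> carrier P" "h \<one>\<^bsub>Q\<^esub> = \<one>\<^bsub>P\<^esub>"
    "\<And>q q'. q \<in> carrier Q \<Longrightarrow> q' \<in> carrier Q \<Longrightarrow> h (q \<otimes>\<^bsub>Q\<^esub> q') = h q \<otimes>\<^bsub>P\<^esub> h q'"
    using loc by (auto simp: local_hom_def monoid_hom_def hom_def)
  have G_carrier[simp]: "g \<in> carrier Q" if "g \<in> G" for g
    using is_face_closed[OF G that] .
  \<comment> \<open>The divisors of images of elements of \<open>G\<close>. These images are closed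
    under products, so the divisors already form the face that they generate.\<close>
  define F where "F = {p \<in> carrier P. \<exists>p'\<in>carrier P. \<exists>g\<in>G. p \<otimes>\<^bsub>P\<^esub> p' = h g}"
  have "is_face P F"
  proof (rule is_faceI)
    show "F \<subseteq> carrier P" "\<one>\<^bsub>P\<^esub> \<in> F"
      using is_face_one[OF G] by (auto simp: F_def intro: bexI[of _ "\<one>\<^bsub>P\<^esub>"] bexI[of _ "\<one>\<^bsub>Q\<^esub>"])
    fix p q assume pq: "p \<in> carrier P" "q \<in> carrier P"
    show "p \<otimes>\<^bsub>P\<^esub> q \<in> F \<longleftrightarrow> p \<in> F \<and> q \<in> F"
    proof
      assume "p \<otimes>\<^bsub>P\<^esub> q \<in> F"
      then obtain r g where r: "r \<in> carrier P" "g \<in> G" "p \<otimes>\<^bsub>P\<^esub> q \<otimes>\<^bsub>P\<^esub> r = h g"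
        by (auto simp: F_def)
      then have "p \<otimes>\<^bsub>P\<^esub> (q \<otimes>\<^bsub>P\<^esub> r) = h g" "q \<otimes>\<^bsub>P\<^esub> (p \<otimes>\<^bsub>P\<^esub> r) = h g"
        using pq by (simp_all add: P.m_ac)
      then show "p \<in> F \<and> q \<in> F"
        using pq r unfolding F_def by blast
    next
      assume "p \<in> F \<and> q \<in> F"
      then obtain p' g q' g' where r: "p' \<in> carrier P" "g \<in> G" "p \<otimes>\<^bsub>P\<^esub> p' = h g"
          "q' \<in> carrier P" "g' \<in> G" "q \<otimes>\<^bsub>P\<^esub> q' = h g'"
        by (auto simp: F_def)
      have "p \<otimes>\<^bsub>P\<^esub> q \<otimes>\<^bsub>P\<^esub> (p' \<otimes>\<^bsub>P\<^esub> q') = p \<otimes>\<^bsub>P\<^esub> p' \<otimes>\<^bsub>P\<^esub> (q \<otimes>\<^bsub>P\<^esub> q')"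
        using pq r(1,4) by (simp add: P.m_ac)
      also have "\<dots> = h (g \<otimes>\<^bsub>Q\<^esub> g')"
        using r by simp
      finally show "p \<otimes>\<^bsub>P\<^esub> q \<in> F"
        using pq r is_face_mult[OF G, of g g'] unfolding F_def
        by (auto intro!: bexI[of _ "p' \<otimes>\<^bsub>P\<^esub> q'"] bexI[of _ "g \<otimes>\<^bsub>Q\<^esub> g'"])
    qed
  qed
  moreover have "q \<in> G" if q: "q \<in> carrier Q" "h q \<in> F" for q
  proof -
    obtain p g where p: "p \<in> carrier P" "g \<in> G" "h q \<otimes>\<^bsub>P\<^esub> p = h g"
      using q by (auto simp: F_def)
    obtain b b' n where b: "b \<in> carrier Q" "b' \<in> carrier Q" "n \<in> carrier P"
      "q \<otimes>\<^bsub>Q\<^esub> b = g \<otimes>\<^bsub>Q\<^esub> b'" "h b' \<otimes>\<^bsub>P\<^esub> n = \<one>\<^bsub>P\<^esub>"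
      using flat_mmodule_equation[OF conjunct2[OF flat[unfolded flat_hom_def]] Q, of q g p "\<one>\<^bsub>P\<^esub>"]
        p q(1) by (fastforce simp: eq_commute)
    have "h b' \<in> Units P"
      using b P.m_comm[of n "h b'"] unfolding Units_def by auto
    then have "b' \<in> Units Q"
      using loc b by (auto simp: local_hom_def)
    then have "q \<otimes>\<^bsub>Q\<^esub> b \<in> G"
      using b(4) p(2) is_face_mult[OF G _ b(2), of g] is_face_Units[OF G] by auto
    then show ?thesis
      using is_face_mult[OF G q(1) b(1)] by blast
  qed
  moreover have "h g \<in> F" if "g \<in> G" for g
    using that unfolding F_def by (auto intro!: bexI[of _ "\<one>\<^bsub>P\<^esub>"] bexI[of _ g])
  ultimately show ?thesis
    by blast
qed

section \<open>Stalks and generizations\<close>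

lemma monoid_homD:
  assumes "h \<in> monoid_hom Q P"
  shows "q \<in> carrier Q \<Longrightarrow> h q \<in> carrier P" "h \<one>\<^bsub>Q\<^esub> = \<one>\<^bsub>P\<^esub>"
    "q \<in> carrier Q \<Longrightarrow> q' \<in> carrier Q \<Longrightarrow> h (q \<otimes>\<^bsub>Q\<^esub> q') = h q \<otimes>\<^bsub>P\<^esub> h q'"
  using assms by (auto simp: monoid_hom_def hom_def)

lemma comm_monoid_UnitsI:
  assumes "comm_monoid P" "p \<in> carrier P" "q \<in> carrier P" "p \<otimes>\<^bsub>P\<^esub> q = \<one>\<^bsub>P\<^esub>"
  shows "p \<in> Units P"
  using assms comm_monoid.m_comm[of P q p] unfolding Units_def by auto

text \<open>In a commutative monoid a divisor of a unit is a unit. So the units form a face, and the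
  faces \<open>unit_face\<close> arise from the units at a generization.\<close>

lemma Units_mult_iff:
  assumes P: "comm_monoid P" and pq: "p \<in> carrier P" "q \<in> carrier P"
  shows "p \<otimes>\<^bsub>P\<^esub> q \<in> Units P \<longleftrightarrow> p \<in> Units P \<and> q \<in> Units P"
proof
  interpret comm_monoid P by fact
  show "p \<otimes>\<^bsub>P\<^esub> q \<in> Units P" if "p \<in> Units P \<and> q \<in> Units P"
    using that by simp
  assume "p \<otimes>\<^bsub>P\<^esub> q \<in> Units P"
  then obtain r where r: "r \<in> carrier P" "p \<otimes>\<^bsub>P\<^esub> q \<otimes>\<^bsub>P\<^esub> r = \<one>\<^bsub>P\<^esub>"
    by (auto simp: Units_def)
  then have "p \<otimes>\<^bsub>P\<^esub> (q \<otimes>\<^bsub>P\<^esub> r) = \<one>\<^bsub>P\<^esub>" "q \<otimes>\<^bsub>P\<^esub> (p \<otimes>\<^bsub>P\<^esub> r) = \<one>\<^bsub>P\<^esub>"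
    using pq by (simp_all add: m_ac)
  then show "p \<in> Units P \<and> q \<in> Units P"
    using pq r(1) comm_monoid_UnitsI[OF P] by blast
qed

text \<open>Invertibility of a germ in terms of sections: unlike the stalk, which is a set of pairs of
  open sets and sections, this does not change under restriction to an open subspace.\<close>

definition unit_at :: "('x, 'm) mspace \<Rightarrow> 'x \<Rightarrow> 'x set \<Rightarrow> 'm \<Rightarrow> bool" where
  "unit_at X x U s \<longleftrightarrow> (\<exists>W t. openin (Top X) W \<and> x \<in> W \<and> W \<subseteq> U \<and> t \<in> carrier (Sec X W) \<and>
    Res X U W s \<otimes>\<^bsub>Sec X W\<^esub> t = \<one>\<^bsub>Sec X W\<^esub>)"

section \<open>Germs and stalks of a presheaf of monoids\<close>

locale monoidal_presheaf =
  fixes X :: "('x, 'm) mspace"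
  assumes presheaf: "presheaf_of_monoids X"
begin

abbreviation opn where "opn U \<equiv> openin (Top X) U"

lemma comm_monoid_Sec: "opn U \<Longrightarrow> comm_monoid (Sec X U)"
  using presheaf by (simp add: presheaf_of_monoids_def)

lemma Res_hom: "opn U \<Longrightarrow> opn V \<Longrightarrow> V \<subseteq> U \<Longrightarrow> Res X U V \<in> monoid_hom (Sec X U) (Sec X V)"
  using presheaf by (simp add: presheaf_of_monoids_def)

lemma Res_id [simp]: "opn U \<Longrightarrow> s \<in> carrier (Sec X U) \<Longrightarrow> Res X U U s = s"
  using presheaf by (simp add: presheaf_of_monoids_def)

lemma Res_Res:
  "opn U \<Longrightarrow> opn V \<Longrightarrow> opn W \<Longrightarrow> W \<subseteq> V \<Longrightarrow> V \<subseteq> U \<Longrightarrow> s \<in> carrier (Sec X U) \<Longrightarrow>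
    Res X V W (Res X U V s) = Res X U W s"
  using presheaf by (simp add: presheaf_of_monoids_def)

lemmas Res_closed = monoid_homD(1)[OF Res_hom]
  and Res_one = monoid_homD(2)[OF Res_hom]
  and Res_mult = monoid_homD(3)[OF Res_hom]

lemma Sec_one: "opn U \<Longrightarrow> \<one>\<^bsub>Sec X U\<^esub> \<in> carrier (Sec X U)"
  by (simp add: comm_monoid_Sec monoid.one_closed comm_monoid.axioms(1))

lemma Sec_mult:
  "opn U \<Longrightarrow> s \<in> carrier (Sec X U) \<Longrightarrow> t \<in> carrier (Sec X U) \<Longrightarrow>
    s \<otimes>\<^bsub>Sec X U\<^esub> t \<in> carrier (Sec X U)"
  by (simp add: comm_monoid_Sec monoid.m_closed comm_monoid.axioms(1))

text \<open>Agreement near \<open>x\<close> is transitive: the sections are compared on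
  \<open>W \<inter> W'\<close>, which is still a neighbourhood of \<open>x\<close>. The other
  inclusion follows by symmetry.\<close>

lemma germ_subset:
  assumes U: "opn U" "s \<in> carrier (Sec X U)" and V: "opn V" "t \<in> carrier (Sec X V)"
    and W: "opn W" "x \<in> W" "W \<subseteq> U \<inter> V" "Res X U W s = Res X V W t"
  shows "germ X x U s \<subseteq> germ X x V t"
proof
  fix r assume "r \<in> germ X x U s"
  then obtain V' t' W' where r: "r = (V', t')" "opn V'" "x \<in> V'" "t' \<in> carrier (Sec X V')"
    and W': "opn W'" "x \<in> W'" "W' \<subseteq> U \<inter> V'" "Res X U W' s = Res X V' W' t'"
    by (auto simp: germ_def)
  have WW: "opn (W \<inter> W')" "W \<inter> W' \<subseteq> V \<inter> V'" "x \<in> W \<inter> W'"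
    using W W' by auto
  have "Res X V (W \<inter> W') t = Res X W (W \<inter> W') (Res X V W t)"
    using V W WW by (subst Res_Res) auto
  also have "\<dots> = Res X U (W \<inter> W') s"
    unfolding W(4)[symmetric] using U W WW by (subst Res_Res) auto
  also have "\<dots> = Res X W' (W \<inter> W') (Res X U W' s)"
    using U W' WW by (subst Res_Res) auto
  also have "\<dots> = Res X V' (W \<inter> W') t'"
    unfolding W'(4) using r W' WW by (subst Res_Res) auto
  finally show "r \<in> germ X x V t"
    using r WW unfolding germ_def by blast
qed

lemma germ_eqI:
  assumes U: "opn U" "s \<in> carrier (Sec X U)" and V: "opn V" "t \<in> carrier (Sec X V)"
    and W: "opn W" "x \<in> W" "W \<subseteq> U \<inter> V" "Res X U W s = Res X V W t"
  shows "germ X x U s = germ X x V t"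
  using germ_subset[OF U V W] germ_subset[OF V U W(1,2) _ W(4)[symmetric]] W(3) by blast

lemma germ_self: "opn U \<Longrightarrow> x \<in> U \<Longrightarrow> s \<in> carrier (Sec X U) \<Longrightarrow> (U, s) \<in> germ X x U s"
  unfolding germ_def by blast

lemma germ_eqD:
  assumes "germ X x U s = germ X x V t" and "opn V" "x \<in> V" "t \<in> carrier (Sec X V)"
  obtains W where "opn W" "x \<in> W" "W \<subseteq> U \<inter> V" "Res X U W s = Res X V W t"
proof -
  have "(V, t) \<in> germ X x U s"
    unfolding assms(1) by (rule germ_self[OF assms(2-4)])
  then have "\<exists>W. opn W \<and> x \<in> W \<and> W \<subseteq> U \<inter> V \<and> Res X U W s = Res X V W t"
    by (simp only: germ_def mem_Collect_eq case_prod_conv)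
  then show thesis
    using that by blast
qed

lemma germ_Res:
  assumes "opn U" "opn V" "x \<in> V" "V \<subseteq> U" "s \<in> carrier (Sec X U)"
  shows "germ X x V (Res X U V s) = germ X x U s"
  by (rule germ_eqI[where W = V]) (use assms Res_closed Res_Res in auto)

text \<open>Operations on stalks are unions over the representatives of a germ. Any two
  representatives have a common restriction near \<open>x\<close>, so a value that does not change
  under restriction is the same for all of them.\<close>

lemma Union_germ:
  assumes U: "opn U" "x \<in> U" "s \<in> carrier (Sec X U)"
    and F: "\<And>V t W. opn V \<Longrightarrow> t \<in> carrier (Sec X V) \<Longrightarrow> opn W \<Longrightarrow> x \<in> W \<Longrightarrow> W \<subseteq> V \<Longrightarrow>
      F V t = F W (Res X V W t)"
  shows "(\<Union>(V, t)\<in>germ X x U s. F V t) = F U s"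
proof -
  have "F V t = F U s" if Vt: "(V, t) \<in> germ X x U s" for V t
  proof -
    obtain W where "opn V" "t \<in> carrier (Sec X V)" "opn W" "x \<in> W" "W \<subseteq> U \<inter> V"
      "Res X U W s = Res X V W t"
      using Vt unfolding germ_def by blast
    then show ?thesis
      using F[of V t W] F[of U s W] U by simp
  qed
  then show ?thesis
    by (intro UN_constant_eq[OF germ_self[OF U]]) auto
qed

lemma germ_closed:
  "opn U \<Longrightarrow> x \<in> U \<Longrightarrow> s \<in> carrier (Sec X U) \<Longrightarrow> germ X x U s \<in> carrier (stalk X x)"
  unfolding stalk_def partial_object.simps by blast

lemma stalk_cases:
  assumes "a \<in> carrier (stalk X x)"
  obtains U s where "opn U" "x \<in> U" "s \<in> carrier (Sec X U)" "a = germ X x U s"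
  using assms unfolding stalk_def partial_object.simps by blast

text \<open>Both germs are given over the same \<open>U\<close>, which keeps intersections out of
  later computations; \<open>stalk_cases2\<close> arranges this for any two germs.\<close>

lemma stalk_mult:
  assumes U: "opn U" "x \<in> U" and st: "s \<in> carrier (Sec X U)" "t \<in> carrier (Sec X U)"
  shows "germ X x U s \<otimes>\<^bsub>stalk X x\<^esub> germ X x U t = germ X x U (s \<otimes>\<^bsub>Sec X U\<^esub> t)"
proof -
  let ?m = "\<lambda>U s V t. germ X x (U \<inter> V)
    (Res X U (U \<inter> V) s \<otimes>\<^bsub>Sec X (U \<inter> V)\<^esub> Res X V (U \<inter> V) t)"
  \<comment> \<open>The product germ can be computed on any neighbourhood \<open>W\<close> of
    \<open>x\<close> inside \<open>U \<inter> V\<close>. This yields the invariance required by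
    \<open>Union_germ\<close>, which is applied once to each factor.\<close>
  have m: "?m U s V t = germ X x W (Res X U W s \<otimes>\<^bsub>Sec X W\<^esub> Res X V W t)"
    if "opn U" "s \<in> carrier (Sec X U)" "opn V" "t \<in> carrier (Sec X V)" "opn W" "x \<in> W" "W \<subseteq> U \<inter> V"
    for U s V t W
  proof (rule germ_eqI[where W = W])
    have UV: "opn (U \<inter> V)"
      using that by auto
    show "Res X (U \<inter> V) W (Res X U (U \<inter> V) s \<otimes>\<^bsub>Sec X (U \<inter> V)\<^esub> Res X V (U \<inter> V) t) =
        Res X W W (Res X U W s \<otimes>\<^bsub>Sec X W\<^esub> Res X V W t)"
      using that UV by (simp add: Res_mult Res_closed Res_Res Sec_mult)
  qed (use that in \<open>auto intro!: Sec_mult Res_closed\<close>)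
  have "(\<Union>(V, t')\<in>germ X x U t. ?m U' s' V t') = ?m U' s' U t"
    if U': "opn U'" "x \<in> U'" "s' \<in> carrier (Sec X U')" for U' s'
  proof (rule Union_germ[OF U st(2)])
    fix V t W assume V: "opn V" "t \<in> carrier (Sec X V)" "opn W" "x \<in> W" "W \<subseteq> V"
    have "?m U' s' V t = germ X x (U' \<inter> W)
        (Res X U' (U' \<inter> W) s' \<otimes>\<^bsub>Sec X (U' \<inter> W)\<^esub> Res X V (U' \<inter> W) t)"
      by (rule m) (use U' V in auto)
    also have "Res X V (U' \<inter> W) t = Res X W (U' \<inter> W) (Res X V W t)"
      using U' V by (subst Res_Res) auto
    finally show "?m U' s' V t = ?m U' s' W (Res X V W t)" .
  qed
  note inner = this
  have "(case r of (U', s') \<Rightarrow> \<Union>(V, t')\<in>germ X x U t. ?m U' s' V t') =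
      (case r of (U', s') \<Rightarrow> ?m U' s' U t)" if r: "r \<in> germ X x U s" for r
  proof -
    have "opn (fst r)" "x \<in> fst r" "snd r \<in> carrier (Sec X (fst r))"
      using r by (auto simp: germ_def)
    from inner[OF this] show ?thesis
      by (simp add: split_beta)
  qed
  then have "germ X x U s \<otimes>\<^bsub>stalk X x\<^esub> germ X x U t = (\<Union>(U', s')\<in>germ X x U s. ?m U' s' U t)"
    unfolding stalk_def monoid.simps by (rule SUP_cong[OF refl])
  also have "\<dots> = ?m U s U t"
  proof (rule Union_germ[OF U st(1)])
    fix V s W assume V: "opn V" "s \<in> carrier (Sec X V)" "opn W" "x \<in> W" "W \<subseteq> V"
    have "?m V s U t = germ X x (W \<inter> U)
        (Res X V (W \<inter> U) s \<otimes>\<^bsub>Sec X (W \<inter> U)\<^esub> Res X U (W \<inter> U) t)"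
      by (rule m) (use U st V in auto)
    also have "Res X V (W \<inter> U) s = Res X W (W \<inter> U) (Res X V W s)"
      using U V by (subst Res_Res) auto
    finally show "?m V s U t = ?m W (Res X V W s) U t" .
  qed
  finally show ?thesis
    using U st by simp
qed

lemma stalk_one:
  assumes "opn U" "x \<in> U"
  shows "\<one>\<^bsub>stalk X x\<^esub> = germ X x U \<one>\<^bsub>Sec X U\<^esub>"
proof -
  let ?T = "topspace (Top X)"
  have UT: "U \<subseteq> ?T" "opn ?T"
    using assms(1) openin_subset by auto
  then have "germ X x U (Res X ?T U \<one>\<^bsub>Sec X ?T\<^esub>) = germ X x ?T \<one>\<^bsub>Sec X ?T\<^esub>"
    using assms Sec_one by (intro germ_Res)
  then show ?thesis
    using assms UT by (simp add: Res_one stalk_def)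
qed

lemma stalk_cases2:
  assumes "a \<in> carrier (stalk X x)" "b \<in> carrier (stalk X x)"
  obtains U s t where "opn U" "x \<in> U" "s \<in> carrier (Sec X U)" "t \<in> carrier (Sec X U)"
    "a = germ X x U s" "b = germ X x U t"
proof -
  obtain U s where U: "opn U" "x \<in> U" "s \<in> carrier (Sec X U)" "a = germ X x U s"
    by (rule stalk_cases[OF assms(1)])
  obtain V t where V: "opn V" "x \<in> V" "t \<in> carrier (Sec X V)" "b = germ X x V t"
    by (rule stalk_cases[OF assms(2)])
  show thesis
    by (rule that[of "U \<inter> V" "Res X U (U \<inter> V) s" "Res X V (U \<inter> V) t"])
      (use U V in \<open>simp_all add: germ_Res Res_closed openin_Int\<close>)
qed

lemma comm_monoid_stalk:
  assumes x: "x \<in> topspace (Top X)"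
  shows "comm_monoid (stalk X x)"
proof (rule comm_monoidI)
  show "\<one>\<^bsub>stalk X x\<^esub> \<in> carrier (stalk X x)"
    using x by (simp add: stalk_one[of "topspace (Top X)"] germ_closed Sec_one)
next
  fix a assume "a \<in> carrier (stalk X x)"
  then obtain U s where U: "opn U" "x \<in> U" "s \<in> carrier (Sec X U)" "a = germ X x U s"
    by (rule stalk_cases)
  interpret comm_monoid "Sec X U"
    by (rule comm_monoid_Sec[OF U(1)])
  show "\<one>\<^bsub>stalk X x\<^esub> \<otimes>\<^bsub>stalk X x\<^esub> a = a"
    using U by (simp add: stalk_one[of U] stalk_mult)
next
  fix a b assume ab: "a \<in> carrier (stalk X x)" "b \<in> carrier (stalk X x)"
  obtain U s t where U: "opn U" "x \<in> U" "s \<in> carrier (Sec X U)" "t \<in> carrier (Sec X U)"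
    "a = germ X x U s" "b = germ X x U t"
    by (rule stalk_cases2[OF ab])
  interpret comm_monoid "Sec X U"
    by (rule comm_monoid_Sec[OF U(1)])
  show "a \<otimes>\<^bsub>stalk X x\<^esub> b \<in> carrier (stalk X x)"
    using U by (simp add: stalk_mult germ_closed)
  show "a \<otimes>\<^bsub>stalk X x\<^esub> b = b \<otimes>\<^bsub>stalk X x\<^esub> a"
    using U by (simp add: stalk_mult m_comm)
  fix c assume "c \<in> carrier (stalk X x)"
  then obtain V r where V: "opn V" "x \<in> V" "r \<in> carrier (Sec X V)" "c = germ X x V r"
    by (rule stalk_cases)
  define W where "W = U \<inter> V"
  have W: "opn W" "x \<in> W" "W \<subseteq> U" "W \<subseteq> V"
    using U V by (auto simp: W_def)
  interpret W: comm_monoid "Sec X W"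
    by (rule comm_monoid_Sec[OF W(1)])
  have "a = germ X x W (Res X U W s)" "b = germ X x W (Res X U W t)" "c = germ X x W (Res X V W r)"
    using U V W by (simp_all add: germ_Res)
  moreover have "Res X U W s \<in> carrier (Sec X W)" "Res X U W t \<in> carrier (Sec X W)"
    "Res X V W r \<in> carrier (Sec X W)"
    using U V W by (simp_all add: Res_closed)
  ultimately show "a \<otimes>\<^bsub>stalk X x\<^esub> b \<otimes>\<^bsub>stalk X x\<^esub> c = a \<otimes>\<^bsub>stalk X x\<^esub> (b \<otimes>\<^bsub>stalk X x\<^esub> c)"
    using W(1,2) by (simp add: stalk_mult W.m_assoc)
qed

text \<open>An inverse germ comes from a section, and the product of the two sections becomes one
  after shrinking; the smaller neighbourhood is the one that \<open>unit_at\<close> asks for.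
  Conversely, an inverse section has a germ.\<close>

lemma germ_Units_iff:
  assumes U: "opn U" "x \<in> U" "s \<in> carrier (Sec X U)"
  shows "germ X x U s \<in> Units (stalk X x) \<longleftrightarrow> unit_at X x U s"
proof
  assume "germ X x U s \<in> Units (stalk X x)"
  then obtain b where b: "b \<in> carrier (stalk X x)" "germ X x U s \<otimes>\<^bsub>stalk X x\<^esub> b = \<one>\<^bsub>stalk X x\<^esub>"
    by (auto simp: Units_def)
  obtain V t where V: "opn V" "x \<in> V" "t \<in> carrier (Sec X V)" "b = germ X x V t"
    by (rule stalk_cases[OF b(1)])
  define W where "W = U \<inter> V"
  have W: "opn W" "x \<in> W" "W \<subseteq> U" "W \<subseteq> V"
    using U V by (auto simp: W_def)
  have "germ X x W (Res X U W s \<otimes>\<^bsub>Sec X W\<^esub> Res X V W t) = germ X x U s \<otimes>\<^bsub>stalk X x\<^esub> b"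
    using U V W by (simp add: germ_Res Res_closed flip: stalk_mult)
  also have "\<dots> = germ X x W \<one>\<^bsub>Sec X W\<^esub>"
    using b W by (simp add: stalk_one)
  finally obtain W' where W': "opn W'" "x \<in> W'" "W' \<subseteq> W"
    "Res X W W' (Res X U W s \<otimes>\<^bsub>Sec X W\<^esub> Res X V W t) = Res X W W' \<one>\<^bsub>Sec X W\<^esub>"
    using W by (elim germ_eqD) (auto simp: Sec_one)
  then have "Res X U W' s \<otimes>\<^bsub>Sec X W'\<^esub> Res X V W' t = \<one>\<^bsub>Sec X W'\<^esub>"
    using U V W by (simp add: Res_mult Res_closed Res_one Res_Res)
  moreover have "Res X V W' t \<in> carrier (Sec X W')" "W' \<subseteq> U"
    using V W W' by (auto intro!: Res_closed)
  ultimately show "unit_at X x U s"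
    unfolding unit_at_def using W' by blast
next
  assume "unit_at X x U s"
  then obtain W t where W: "opn W" "x \<in> W" "W \<subseteq> U" "t \<in> carrier (Sec X W)"
    "Res X U W s \<otimes>\<^bsub>Sec X W\<^esub> t = \<one>\<^bsub>Sec X W\<^esub>"
    unfolding unit_at_def by blast
  interpret comm_monoid "stalk X x"
    using U openin_subset by (intro comm_monoid_stalk) blast
  have "germ X x U s \<otimes>\<^bsub>stalk X x\<^esub> germ X x W t = \<one>\<^bsub>stalk X x\<^esub>"
    using U W stalk_mult[of W x "Res X U W s" t] by (simp add: germ_Res Res_closed stalk_one[OF W(1,2)])
  moreover have "germ X x U s \<in> carrier (stalk X x)" "germ X x W t \<in> carrier (stalk X x)"
    using U W germ_closed by auto
  ultimately show "germ X x U s \<in> Units (stalk X x)"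
    using comm_monoid_UnitsI[OF comm_monoid_axioms] by blast
qed

lemma unit_at_Res:
  assumes "opn U" "opn V" "x \<in> V" "V \<subseteq> U" "s \<in> carrier (Sec X U)"
  shows "unit_at X x V (Res X U V s) \<longleftrightarrow> unit_at X x U s"
proof -
  have "x \<in> U" "Res X U V s \<in> carrier (Sec X V)"
    using assms by (auto intro!: Res_closed)
  then show ?thesis
    using germ_Units_iff[of V x "Res X U V s"] germ_Units_iff[of U x s] assms
    by (simp only: germ_Res[OF assms])
qed

lemma unit_at_mult_iff:
  assumes U: "opn U" "x \<in> U" "s \<in> carrier (Sec X U)" "t \<in> carrier (Sec X U)"
  shows "unit_at X x U (s \<otimes>\<^bsub>Sec X U\<^esub> t) \<longleftrightarrow> unit_at X x U s \<and> unit_at X x U t"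
proof -
  have "comm_monoid (stalk X x)"
    using U openin_subset by (intro comm_monoid_stalk) blast
  then have "germ X x U (s \<otimes>\<^bsub>Sec X U\<^esub> t) \<in> Units (stalk X x) \<longleftrightarrow>
      germ X x U s \<in> Units (stalk X x) \<and> germ X x U t \<in> Units (stalk X x)"
    using U by (simp add: Units_mult_iff germ_closed flip: stalk_mult)
  then show ?thesis
    using U by (simp add: germ_Units_iff Sec_mult)
qed

lemma unit_at_one:
  assumes U: "opn U" "x \<in> U"
  shows "unit_at X x U \<one>\<^bsub>Sec X U\<^esub>"
proof -
  interpret comm_monoid "stalk X x"
    using U openin_subset by (intro comm_monoid_stalk) blast
  show ?thesis
    using U by (simp add: Sec_one flip: germ_Units_iff stalk_one)
qed

section \<open>Faces of a stalk and generizations\<close>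

text \<open>For a point \<open>x\<close> of the space this says that \<open>x\<close> lies in the
  closure of \<open>x'\<close>. For \<open>x\<close> outside the space the condition is vacuous, so
  results about it place \<open>x\<close> in the space.\<close>

definition generizations :: "'x \<Rightarrow> 'x set" where
  "generizations x = {x'. \<forall>U. opn U \<and> x \<in> U \<longrightarrow> x' \<in> U}"

text \<open>The preimage of the units under the map from the stalk at \<open>x\<close> to the stalk
  at \<open>x'\<close>, expressed through sections so that this map need not be constructed.\<close>

definition unit_face :: "'x \<Rightarrow> 'x \<Rightarrow> ('x set \<times> 'm) set set" where
  "unit_face x x' =
    {germ X x U s |U s. opn U \<and> x \<in> U \<and> s \<in> carrier (Sec X U) \<and> unit_at X x' U s}"

text \<open>Two sections with the same germ at \<open>x\<close> agree on a neighbourhood of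
  \<open>x\<close>, which also contains \<open>x'\<close>; so invertibility at \<open>x'\<close>
  depends on the germ at \<open>x\<close> alone.\<close>

lemma germ_unit_face_iff:
  assumes x': "x' \<in> generizations x" and U: "opn U" "x \<in> U" "s \<in> carrier (Sec X U)"
  shows "germ X x U s \<in> unit_face x x' \<longleftrightarrow> unit_at X x' U s"
proof
  assume "germ X x U s \<in> unit_face x x'"
  then obtain V t where V: "germ X x U s = germ X x V t" "opn V" "x \<in> V" "t \<in> carrier (Sec X V)"
    "unit_at X x' V t"
    unfolding unit_face_def by blast
  obtain W where W: "opn W" "x \<in> W" "W \<subseteq> U \<inter> V" "Res X U W s = Res X V W t"
    by (rule germ_eqD[OF V(1-4)])
  have "x' \<in> W"
    using x' W by (simp add: generizations_def)
  then show "unit_at X x' U s"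
    using U V W unit_at_Res[of U W x' s] unit_at_Res[of V W x' t] by simp
next
  assume "unit_at X x' U s"
  then show "germ X x U s \<in> unit_face x x'"
    using U unfolding unit_face_def by blast
qed

lemma is_face_unit_face:
  assumes x: "x \<in> topspace (Top X)" and x': "x' \<in> generizations x"
  shows "is_face (stalk X x) (unit_face x x')"
proof (rule is_faceI)
  show "unit_face x x' \<subseteq> carrier (stalk X x)"
    using germ_closed unfolding unit_face_def by blast
  have "x' \<in> topspace (Top X)"
    using x x' by (auto simp: generizations_def)
  then show "\<one>\<^bsub>stalk X x\<^esub> \<in> unit_face x x'"
    using x x' by (simp add: stalk_one[of "topspace (Top X)"] germ_unit_face_iff Sec_one unit_at_one)
  fix a b assume ab: "a \<in> carrier (stalk X x)" "b \<in> carrier (stalk X x)"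
  obtain U s t where U: "opn U" "x \<in> U" "s \<in> carrier (Sec X U)" "t \<in> carrier (Sec X U)"
    "a = germ X x U s" "b = germ X x U t"
    by (rule stalk_cases2[OF ab])
  moreover have "x' \<in> U"
    using x' U by (simp add: generizations_def)
  ultimately show "a \<otimes>\<^bsub>stalk X x\<^esub> b \<in> unit_face x x' \<longleftrightarrow> a \<in> unit_face x x' \<and> b \<in> unit_face x x'"
    using x' by (simp add: stalk_mult germ_unit_face_iff unit_at_mult_iff Sec_mult)
qed

end

section \<open>Morphisms and open subspaces\<close>

lemma locally_monoidal_presheaf: "locally_monoidal_space X \<Longrightarrow> monoidal_presheaf X"
  by (simp add: monoidal_presheaf_def locally_monoidal_space_def)

lemma mspace_morphismD:
  assumes "mspace_morphism X Y f \<phi>"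
  shows "monoidal_presheaf X" "monoidal_presheaf Y" "continuous_map (Top X) (Top Y) f"
    "openin (Top Y) V \<Longrightarrow> \<phi> V \<in> monoid_hom (Sec Y V) (Sec X (preim X f V))"
    "openin (Top Y) V \<Longrightarrow> openin (Top Y) W \<Longrightarrow> W \<subseteq> V \<Longrightarrow> t \<in> carrier (Sec Y V) \<Longrightarrow>
      \<phi> W (Res Y V W t) = Res X (preim X f V) (preim X f W) (\<phi> V t)"
    "x \<in> topspace (Top X) \<Longrightarrow> local_hom (stalk Y (f x)) (stalk X x) (stalk_map X f \<phi> x)"
  using assms by (auto simp: mspace_morphism_def intro: locally_monoidal_presheaf)

lemma mspace_morphism_preim:
  assumes "mspace_morphism X Y f \<phi>" "openin (Top Y) V"
  shows "openin (Top X) (preim X f V)"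
  using mspace_morphismD(3)[OF assms(1)] assms(2) by (simp add: preim_def continuous_map_def)

text \<open>Since \<open>\<phi>\<close> commutes with restriction, the germ on the right does not
  depend on the representative.\<close>

lemma stalk_map_germ:
  assumes f: "mspace_morphism X Y f \<phi>" and x: "x \<in> topspace (Top X)"
    and V: "openin (Top Y) V" "f x \<in> V" "t \<in> carrier (Sec Y V)"
  shows "stalk_map X f \<phi> x (germ Y (f x) V t) = germ X x (preim X f V) (\<phi> V t)"
proof -
  interpret X: monoidal_presheaf X by (rule mspace_morphismD(1)[OF f])
  interpret Y: monoidal_presheaf Y by (rule mspace_morphismD(2)[OF f])
  note opn = mspace_morphism_preim[OF f] and hom = monoid_homD[OF mspace_morphismD(4)[OF f]]
  show ?thesis
    unfolding stalk_map_def
  proof (rule Y.Union_germ[OF V])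
    fix V t W
    assume V: "Y.opn V" "t \<in> carrier (Sec Y V)" and W: "Y.opn W" "f x \<in> W" "W \<subseteq> V"
    have "x \<in> preim X f W" "preim X f W \<subseteq> preim X f V"
      using W x by (auto simp: preim_def)
    then show "germ X x (preim X f V) (\<phi> V t) = germ X x (preim X f W) (\<phi> W (Res Y V W t))"
      using mspace_morphismD(5)[OF f V(1) W(1,3) V(2)] opn V W hom by (simp add: X.germ_Res)
  qed
qed

text \<open>This is locality of the stalk map at \<open>x\<close>, in terms of sections: a
  homomorphism preserves units, and a local one also reflects them.\<close>

lemma unit_at_morphism:
  assumes f: "mspace_morphism X Y f \<phi>" and x: "x \<in> topspace (Top X)"
    and V: "openin (Top Y) V" "f x \<in> V" "t \<in> carrier (Sec Y V)"
  shows "unit_at X x (preim X f V) (\<phi> V t) \<longleftrightarrow> unit_at Y (f x) V t"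
proof -
  interpret X: monoidal_presheaf X by (rule mspace_morphismD(1)[OF f])
  interpret Y: monoidal_presheaf Y by (rule mspace_morphismD(2)[OF f])
  have "germ Y (f x) V t \<in> Units (stalk Y (f x)) \<longleftrightarrow>
      stalk_map X f \<phi> x (germ Y (f x) V t) \<in> Units (stalk X x)"
    using mspace_morphismD(6)[OF f x] Y.germ_closed[OF V] by (auto simp: local_hom_def)
  moreover have "x \<in> preim X f V"
    using x V by (simp add: preim_def)
  ultimately show ?thesis
    using monoid_homD(1)[OF mspace_morphismD(4)[OF f V(1)] V(3)] V mspace_morphism_preim[OF f V(1)]
    by (simp add: stalk_map_germ[OF f x V] Y.germ_Units_iff X.germ_Units_iff)
qed

text \<open>A neighbourhood that witnesses invertibility lies in \<open>V\<close>, hence in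
  \<open>U\<close>, where the subspace has the same open sets and the same sections.\<close>

lemma unit_at_open_subspace:
  assumes "openin (Top X) U" "V \<subseteq> U"
  shows "unit_at (open_subspace X U) x V s \<longleftrightarrow> unit_at X x V s"
  using assms unfolding unit_at_def open_subspace_def
  by (simp add: openin_open_subtopology) (meson subset_trans)

section \<open>Localization\<close>

locale localized_monoid = comm_monoid P + denominators: submonoid S P
  for P :: "'p monoid" (structure) and S :: "'p set"
begin

abbreviation frac where "frac \<equiv> loc_frac P S"
abbreviation loc where "loc \<equiv> localization P S"

text \<open>Transitivity of the relation between fractions, with cancelling factor
  \<open>u \<otimes> v \<otimes> s\<close>: \<open>u\<close> and \<open>v\<close> come from the two
  relations, and \<open>s\<close> is the denominator of the fraction in the middle.\<close>

lemma frac_subset: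
  assumes a: "a \<in> carrier P" "s \<in> S" and b: "b \<in> carrier P" "t \<in> S"
    and u: "u \<in> S" "u \<otimes> (a \<otimes> t) = u \<otimes> (b \<otimes> s)"
  shows "frac a s \<subseteq> frac b t"
proof (rule subrelI)
  fix c r assume "(c, r) \<in> frac a s"
  then obtain v where c: "c \<in> carrier P" "r \<in> S"
    and v: "v \<in> S" "v \<otimes> (a \<otimes> r) = v \<otimes> (c \<otimes> s)"
    unfolding loc_frac_def by blast
  note mem = a b c(1) denominators.mem_carrier[OF c(2)] denominators.mem_carrier[OF a(2)]
    denominators.mem_carrier[OF b(2)] denominators.mem_carrier[OF u(1)] denominators.mem_carrier[OF v(1)]
  have "u \<otimes> v \<otimes> s \<otimes> (b \<otimes> r) = v \<otimes> r \<otimes> (u \<otimes> (b \<otimes> s))"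
    using mem by (simp add: m_ac)
  also have "\<dots> = u \<otimes> t \<otimes> (v \<otimes> (a \<otimes> r))"
    unfolding u(2)[symmetric] using mem by (simp add: m_ac)
  also have "\<dots> = u \<otimes> v \<otimes> s \<otimes> (c \<otimes> t)"
    unfolding v(2) using mem by (simp add: m_ac)
  finally have "u \<otimes> v \<otimes> s \<otimes> (b \<otimes> r) = u \<otimes> v \<otimes> s \<otimes> (c \<otimes> t)" .
  moreover have "u \<otimes> v \<otimes> s \<in> S"
    using a u v by simp
  ultimately show "(c, r) \<in> frac b t"
    using c unfolding loc_frac_def by blast
qed

lemma frac_eqI:
  assumes a: "a \<in> carrier P" "s \<in> S" and b: "b \<in> carrier P" "t \<in> S"
    and u: "u \<in> S" "u \<otimes> (a \<otimes> t) = u \<otimes> (b \<otimes> s)"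
  shows "frac a s = frac b t"
  using frac_subset[OF a b u] frac_subset[OF b a u(1) u(2)[symmetric]] by (rule equalityI)

lemma frac_self: "a \<in> carrier P \<Longrightarrow> s \<in> S \<Longrightarrow> (a, s) \<in> frac a s"
  unfolding loc_frac_def using denominators.one_closed by blast

lemma frac_eqD:
  assumes "frac a s = frac b t" "b \<in> carrier P" "t \<in> S"
  shows "\<exists>u\<in>S. u \<otimes> (a \<otimes> t) = u \<otimes> (b \<otimes> s)"
  using frac_self[OF assms(2,3)] unfolding assms(1)[symmetric]
  by (simp only: loc_frac_def mem_Collect_eq case_prod_conv)

text \<open>The counterpart of \<open>Union_germ\<close> for fractions: a value that respects the
  relation between fractions turns the union into that value.\<close>

lemma Union_frac:
  assumes as: "a \<in> carrier P" "s \<in> S"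
    and F: "\<And>b t u. b \<in> carrier P \<Longrightarrow> t \<in> S \<Longrightarrow> u \<in> S \<Longrightarrow>
      u \<otimes> (a \<otimes> t) = u \<otimes> (b \<otimes> s) \<Longrightarrow> F b t = F a s"
  shows "(\<Union>(b, t)\<in>frac a s. F b t) = F a s"
proof (rule UN_constant_eq[OF frac_self[OF as]], rule ballI)
  fix r assume "r \<in> frac a s"
  then obtain b t u where "r = (b, t)" "b \<in> carrier P" "t \<in> S" "u \<in> S"
    "u \<otimes> (a \<otimes> t) = u \<otimes> (b \<otimes> s)"
    unfolding loc_frac_def by blast
  then show "(case r of (b, t) \<Rightarrow> F b t) = F a s"
    using F by simp
qed

lemma frac_mult:
  assumes a: "a \<in> carrier P" "s \<in> S" and b: "b \<in> carrier P" "t \<in> S"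
  shows "frac a s \<otimes>\<^bsub>loc\<^esub> frac b t = frac (a \<otimes> b) (s \<otimes> t)"
proof -
  have cong: "frac (a' \<otimes> b) (s' \<otimes> t) = frac (a \<otimes> b) (s \<otimes> t)"
    if a: "a \<in> carrier P" "s \<in> S" and b: "b \<in> carrier P" "t \<in> S"
      and a': "a' \<in> carrier P" "s' \<in> S" and u: "u \<in> S" "u \<otimes> (a \<otimes> s') = u \<otimes> (a' \<otimes> s)"
    for a s b t a' s' u
  proof (rule frac_eqI[OF _ _ _ _ u(1)])
    have "u \<otimes> (a' \<otimes> b \<otimes> (s \<otimes> t)) = u \<otimes> (a' \<otimes> s) \<otimes> (b \<otimes> t)"
      using that by (simp add: m_ac)
    also have "\<dots> = u \<otimes> (a \<otimes> b \<otimes> (s' \<otimes> t))"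
      unfolding u(2)[symmetric] using that(1-7) by (simp add: m_ac)
    finally show "u \<otimes> (a' \<otimes> b \<otimes> (s \<otimes> t)) = u \<otimes> (a \<otimes> b \<otimes> (s' \<otimes> t))" .
  qed (use that(1-6) in auto)
  have "frac a s \<otimes>\<^bsub>loc\<^esub> frac b t =
      (\<Union>(a, s)\<in>frac a s. \<Union>(b, t)\<in>frac b t. frac (a \<otimes> b) (s \<otimes> t))"
    by (simp add: localization_def)
  also have "\<dots> = (\<Union>(b, t)\<in>frac b t. frac (a \<otimes> b) (s \<otimes> t))"
  proof (rule Union_frac[OF a])
    fix a' s' u assume a': "a' \<in> carrier P" "s' \<in> S" "u \<in> S" "u \<otimes> (a \<otimes> s') = u \<otimes> (a' \<otimes> s)"
    have "frac (a' \<otimes> fst r) (s' \<otimes> snd r) = frac (a \<otimes> fst r) (s \<otimes> snd r)" if "r \<in> frac b t" for r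
    proof (rule cong[OF a _ _ a'])
      show "fst r \<in> carrier P" "snd r \<in> S"
        using that by (auto simp: loc_frac_def)
    qed
    then show "(\<Union>(b, t)\<in>frac b t. frac (a' \<otimes> b) (s' \<otimes> t)) =
        (\<Union>(b, t)\<in>frac b t. frac (a \<otimes> b) (s \<otimes> t))"
      unfolding split_beta by (rule SUP_cong[OF refl])
  qed
  also have "\<dots> = frac (a \<otimes> b) (s \<otimes> t)"
  proof (rule Union_frac[OF b])
    fix b' t' u assume b': "b' \<in> carrier P" "t' \<in> S" "u \<in> S" "u \<otimes> (b \<otimes> t') = u \<otimes> (b' \<otimes> t)"
    \<comment> \<open>By commutativity the congruence in the first factor also serves for the
      second.\<close>
    show "frac (a \<otimes> b') (s \<otimes> t') = frac (a \<otimes> b) (s \<otimes> t)"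
      using cong[OF b a b'] a b b'(1,2) by (simp add: m_comm[of a] m_comm[of s])
  qed
  finally show ?thesis .
qed

lemma frac_closed: "a \<in> carrier P \<Longrightarrow> s \<in> S \<Longrightarrow> frac a s \<in> carrier loc"
  unfolding localization_def partial_object.simps by blast

lemma loc_cases:
  assumes "x \<in> carrier loc"
  obtains a s where "a \<in> carrier P" "s \<in> S" "x = frac a s"
  using assms unfolding localization_def partial_object.simps by blast

lemma loc_one: "\<one>\<^bsub>loc\<^esub> = frac \<one> \<one>"
  by (simp add: localization_def)

lemma frac_eq_one: "s \<in> S \<Longrightarrow> frac s s = \<one>\<^bsub>loc\<^esub>"
  unfolding loc_one by (rule frac_eqI[of _ _ _ _ \<one>]) auto

lemma comm_monoid_localization: "comm_monoid loc"
proof (rule comm_monoidI)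
  show "\<one>\<^bsub>loc\<^esub> \<in> carrier loc"
    unfolding loc_one by (rule frac_closed) auto
next
  fix x assume "x \<in> carrier loc"
  then obtain a s where "a \<in> carrier P" "s \<in> S" "x = frac a s"
    by (rule loc_cases)
  then show "\<one>\<^bsub>loc\<^esub> \<otimes>\<^bsub>loc\<^esub> x = x"
    by (simp add: loc_one frac_mult)
next
  fix x y assume "x \<in> carrier loc" "y \<in> carrier loc"
  then obtain a s b t where x: "a \<in> carrier P" "s \<in> S" "x = frac a s"
    and y: "b \<in> carrier P" "t \<in> S" "y = frac b t"
    by (meson loc_cases)
  show "x \<otimes>\<^bsub>loc\<^esub> y \<in> carrier loc"
    using x y by (simp add: frac_mult frac_closed)
  show "x \<otimes>\<^bsub>loc\<^esub> y = y \<otimes>\<^bsub>loc\<^esub> x"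
    using x y by (simp add: frac_mult m_comm)
  fix z assume "z \<in> carrier loc"
  then obtain c r where "c \<in> carrier P" "r \<in> S" "z = frac c r"
    by (rule loc_cases)
  then show "x \<otimes>\<^bsub>loc\<^esub> y \<otimes>\<^bsub>loc\<^esub> z = x \<otimes>\<^bsub>loc\<^esub> (y \<otimes>\<^bsub>loc\<^esub> z)"
    using x y by (simp add: frac_mult m_assoc)
qed

lemma frac_one_mult:
  "a \<in> carrier P \<Longrightarrow> b \<in> carrier P \<Longrightarrow> frac a \<one> \<otimes>\<^bsub>loc\<^esub> frac b \<one> = frac (a \<otimes> b) \<one>"
  by (simp add: frac_mult)

text \<open>To become invertible, an element only has to divide a denominator. This is the situation
  of an inclusion of basic open sets, where \<open>p\<close> divides a power of the localizing
  element.\<close>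

lemma frac_Units:
  assumes "p \<in> carrier P" "a \<in> carrier P" "p \<otimes> a \<in> S"
  shows "frac p \<one> \<in> Units loc"
proof (rule comm_monoid_UnitsI[OF comm_monoid_localization])
  show "frac p \<one> \<otimes>\<^bsub>loc\<^esub> frac a (p \<otimes> a) = \<one>\<^bsub>loc\<^esub>"
    using assms by (simp add: frac_mult frac_eq_one)
qed (use assms frac_closed in auto)

end

lemma comm_monoid_Units_cancel:
  assumes "comm_monoid P" "u \<in> Units P" "a \<in> carrier P" "b \<in> carrier P" "u \<otimes>\<^bsub>P\<^esub> a = u \<otimes>\<^bsub>P\<^esub> b"
  shows "a = b"
proof -
  interpret comm_monoid P by fact
  show ?thesis
    using assms by (simp add: Units_l_cancel)
qed

text \<open>\<open>localization_map_frac\<close> determines the image of \<open>a - s\<close>, since \<open>s\<close> is invertible in the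
  target.\<close>

lemma localization_map_frac:
  assumes S: "localized_monoid P S" and T: "localized_monoid P T"
    and unit: "\<And>s. s \<in> S \<Longrightarrow> loc_frac P T s \<one>\<^bsub>P\<^esub> \<in> Units (localization P T)"
    and a: "a \<in> carrier P" "s \<in> S"
  shows "localization_map P S T (loc_frac P S a s) \<in> carrier (localization P T)"
    and "loc_frac P T s \<one>\<^bsub>P\<^esub> \<otimes>\<^bsub>localization P T\<^esub> localization_map P S T (loc_frac P S a s) =
      loc_frac P T a \<one>\<^bsub>P\<^esub>"
proof -
  interpret S: localized_monoid P S by (rule S)
  interpret T: localized_monoid P T by (rule T)
  interpret L: comm_monoid T.loc by (rule T.comm_monoid_localization)
  let ?F = "\<lambda>a s. T.frac a \<one>\<^bsub>P\<^esub> \<otimes>\<^bsub>T.loc\<^esub> inv\<^bsub>T.loc\<^esub> (T.frac s \<one>\<^bsub>P\<^esub>)"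
  have frac: "T.frac a \<one>\<^bsub>P\<^esub> \<in> carrier T.loc" if "a \<in> carrier P" for a
    using that by (simp add: T.frac_closed)
  have F_closed: "?F a s \<in> carrier T.loc" if "a \<in> carrier P" "s \<in> S" for a s
    using that frac unit by simp
  have F_mult: "T.frac s \<one>\<^bsub>P\<^esub> \<otimes>\<^bsub>T.loc\<^esub> ?F a s = T.frac a \<one>\<^bsub>P\<^esub>" if "a \<in> carrier P" "s \<in> S" for a s
  proof -
    have "T.frac s \<one>\<^bsub>P\<^esub> \<in> carrier T.loc" "inv\<^bsub>T.loc\<^esub> (T.frac s \<one>\<^bsub>P\<^esub>) \<in> carrier T.loc"
      using unit[OF that(2)] by auto
    then show ?thesis
      using L.m_lcomm[OF _ frac[OF that(1)]] L.Units_r_inv[OF unit[OF that(2)]] frac[OF that(1)]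
      by simp
  qed
  have "localization_map P S T (S.frac a s) = ?F a s"
    unfolding localization_map_def
  proof (rule S.Union_frac[OF a])
    fix b t u assume b: "b \<in> carrier P" "t \<in> S" "u \<in> S"
      "u \<otimes>\<^bsub>P\<^esub> (a \<otimes>\<^bsub>P\<^esub> t) = u \<otimes>\<^bsub>P\<^esub> (b \<otimes>\<^bsub>P\<^esub> s)"
    have mem: "s \<in> carrier P" "t \<in> carrier P" "u \<in> carrier P"
      using a b S.denominators.mem_carrier by auto
    \<comment> \<open>Multiplication by the images of \<open>u\<close>, \<open>s\<close> and
      \<open>t\<close> clears both denominators and makes the relation between the numerators
      applicable; as a unit, \<open>?w\<close> can be cancelled afterwards.\<close>
    let ?w = "T.frac u \<one>\<^bsub>P\<^esub> \<otimes>\<^bsub>T.loc\<^esub> (T.frac s \<one>\<^bsub>P\<^esub> \<otimes>\<^bsub>T.loc\<^esub> T.frac t \<one>\<^bsub>P\<^esub>)"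
    have w: "?w \<in> Units T.loc"
      using a b unit by simp
    have "?w \<otimes>\<^bsub>T.loc\<^esub> ?F b t = T.frac u \<one>\<^bsub>P\<^esub> \<otimes>\<^bsub>T.loc\<^esub> (T.frac s \<one>\<^bsub>P\<^esub> \<otimes>\<^bsub>T.loc\<^esub> (T.frac t \<one>\<^bsub>P\<^esub> \<otimes>\<^bsub>T.loc\<^esub> ?F b t))"
      using b mem frac F_closed[OF b(1,2)] by (simp add: L.m_assoc del: L.Units_inv_closed)
    also have "\<dots> = T.frac (u \<otimes>\<^bsub>P\<^esub> (b \<otimes>\<^bsub>P\<^esub> s)) \<one>\<^bsub>P\<^esub>"
      unfolding F_mult[OF b(1,2)] using b(1) mem by (simp add: T.frac_one_mult S.m_comm)
    also have "\<dots> = T.frac u \<one>\<^bsub>P\<^esub> \<otimes>\<^bsub>T.loc\<^esub> (T.frac t \<one>\<^bsub>P\<^esub> \<otimes>\<^bsub>T.loc\<^esub> (T.frac s \<one>\<^bsub>P\<^esub> \<otimes>\<^bsub>T.loc\<^esub> ?F a s))"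
      unfolding F_mult[OF a] b(4)[symmetric] using a(1) mem by (simp add: T.frac_one_mult S.m_comm)
    also have "\<dots> = ?w \<otimes>\<^bsub>T.loc\<^esub> ?F a s"
      using mem frac F_closed[OF a] by (simp add: L.m_ac del: L.Units_inv_closed)
    finally show "?F b t = ?F a s"
      by (rule comm_monoid_Units_cancel[OF L.comm_monoid_axioms w F_closed[OF b(1,2)] F_closed[OF a]])
  qed
  then show "localization_map P S T (S.frac a s) \<in> carrier T.loc"
    "T.frac s \<one>\<^bsub>P\<^esub> \<otimes>\<^bsub>T.loc\<^esub> localization_map P S T (S.frac a s) = T.frac a \<one>\<^bsub>P\<^esub>"
    using F_closed[OF a] F_mult[OF a] by simp_all
qed

section \<open>Spectra\<close>

lemma is_face_pow:
  assumes F: "is_face P F" and P: "comm_monoid P" and p: "p \<in> F"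
  shows "powers P p \<subseteq> F"
proof -
  interpret comm_monoid P by fact
  have "p [^]\<^bsub>P\<^esub> (n::nat) \<in> F" for n
    using p is_face_closed[OF F] by (induction n) (auto simp: is_face_one[OF F] is_face_mult[OF F])
  then show ?thesis
    by (auto simp: powers_def)
qed

lemma basic_open_iff: "F \<in> basic_open P p \<longleftrightarrow> is_face P F \<and> p \<in> F"
  by (simp only: basic_open_def faces_def mem_Collect_eq)

locale spectrum = comm_monoid G for G :: "'p monoid" (structure)
begin

lemma powers_self: "p \<in> carrier G \<Longrightarrow> p \<in> powers G p"
  unfolding powers_def by (rule range_eqI[of _ _ 1]) simp

lemma submonoid_powers: "p \<in> carrier G \<Longrightarrow> submonoid (powers G p) G"
proof (rule submonoid.intro)
  assume p: "p \<in> carrier G"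
  then show "powers G p \<subseteq> carrier G"
    by (auto simp: powers_def)
  show "\<one> \<in> powers G p"
    unfolding powers_def by (rule range_eqI[of _ _ 0]) simp
  fix x y assume "x \<in> powers G p" "y \<in> powers G p"
  then obtain m n :: nat where "x = p [^] m" "y = p [^] n"
    by (auto simp: powers_def)
  then show "x \<otimes> y \<in> powers G p"
    using p unfolding powers_def by (intro range_eqI[of _ _ "m + n"]) (simp add: nat_pow_mult)
qed

lemma localized_powers: "p \<in> carrier G \<Longrightarrow> localized_monoid G (powers G p)"
  by (simp add: localized_monoid_def submonoid_powers comm_monoid_axioms)

text \<open>The divisors of powers of \<open>r\<close> form the smallest face that contains
  \<open>r\<close>, the point at which inclusions between basic open sets are tested.\<close>

lemma is_face_factors_of_powers:
  assumes r: "r \<in> carrier G"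
  shows "is_face G {a \<in> carrier G. \<exists>b\<in>carrier G. a \<otimes> b \<in> powers G r}"
proof -
  interpret submonoid "powers G r" G
    by (rule submonoid_powers[OF r])
  show ?thesis
  proof (rule is_faceI)
    show "\<one> \<in> {a \<in> carrier G. \<exists>b\<in>carrier G. a \<otimes> b \<in> powers G r}"
      by (auto intro!: bexI[of _ \<one>])
    fix p q assume pq: "p \<in> carrier G" "q \<in> carrier G"
    show "p \<otimes> q \<in> {a \<in> carrier G. \<exists>b\<in>carrier G. a \<otimes> b \<in> powers G r} \<longleftrightarrow>
      p \<in> {a \<in> carrier G. \<exists>b\<in>carrier G. a \<otimes> b \<in> powers G r} \<and>
      q \<in> {a \<in> carrier G. \<exists>b\<in>carrier G. a \<otimes> b \<in> powers G r}"
    proof safe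
      fix b assume b: "b \<in> carrier G" "p \<otimes> q \<otimes> b \<in> powers G r"
      then have "p \<otimes> (q \<otimes> b) \<in> powers G r" "q \<otimes> (p \<otimes> b) \<in> powers G r"
        using pq by (simp_all add: m_ac)
      then show "\<exists>b\<in>carrier G. p \<otimes> b \<in> powers G r" "\<exists>b\<in>carrier G. q \<otimes> b \<in> powers G r"
        using pq b by blast+
    next
      fix b c assume bc: "b \<in> carrier G" "c \<in> carrier G" and "p \<otimes> b \<in> powers G r" "q \<otimes> c \<in> powers G r"
      then have "p \<otimes> b \<otimes> (q \<otimes> c) \<in> powers G r"
        by simp
      also have "p \<otimes> b \<otimes> (q \<otimes> c) = p \<otimes> q \<otimes> (b \<otimes> c)"
        using pq bc by (simp add: m_ac)
      finally show "\<exists>b\<in>carrier G. p \<otimes> q \<otimes> b \<in> powers G r"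
        using bc by blast
    qed (use pq in auto)
  qed auto
qed

text \<open>The smallest face containing \<open>r\<close> belongs to the first basic open set, hence
  to the second, so it contains \<open>p\<close>. This turns an inclusion of open sets into
  divisibility.\<close>

lemma basic_open_subset_dvd:
  assumes r: "r \<in> carrier G" and sub: "basic_open G r \<subseteq> basic_open G p"
  shows "\<exists>a\<in>carrier G. p \<otimes> a \<in> powers G r"
proof -
  have "{a \<in> carrier G. \<exists>b\<in>carrier G. a \<otimes> b \<in> powers G r} \<in> basic_open G r"
    unfolding basic_open_iff using r is_face_factors_of_powers[OF r] powers_self[OF r]
    by (auto intro!: bexI[of _ \<one>])
  then have "{a \<in> carrier G. \<exists>b\<in>carrier G. a \<otimes> b \<in> powers G r} \<in> basic_open G p"
    using sub by blast
  then show ?thesis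
    by (simp add: basic_open_iff)
qed

lemma basic_open_powers: "s \<in> powers G p \<Longrightarrow> basic_open G p \<subseteq> basic_open G s"
  by (auto simp: basic_open_iff dest: subsetD[OF is_face_pow[OF _ comm_monoid_axioms]])

lemma basic_open_mult:
  "p \<in> carrier G \<Longrightarrow> q \<in> carrier G \<Longrightarrow>
    basic_open G (p \<otimes> q) = basic_open G p \<inter> basic_open G q"
  by (auto simp: basic_open_iff is_face_mult)

lemma frac_Units_of_basic_open:
  assumes "p \<in> carrier G" "r \<in> carrier G" "basic_open G r \<subseteq> basic_open G p"
  shows "loc_frac G (powers G r) p \<one> \<in> Units (localize_at G r)"
proof -
  interpret localized_monoid G "powers G r"
    by (rule localized_powers[OF assms(2)])
  show ?thesis
    using basic_open_subset_dvd[OF assms(2,3)] frac_Units[OF assms(1)] by (auto simp: localize_at_def)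
qed

lemma powers_Units:
  assumes "p \<in> carrier G" "r \<in> carrier G" "basic_open G r \<subseteq> basic_open G p" "s \<in> powers G p"
  shows "loc_frac G (powers G r) s \<one> \<in> Units (localize_at G r)"
  using assms submonoid.mem_carrier[OF submonoid_powers[OF assms(1)] assms(4)] basic_open_powers[OF assms(4)]
  by (intro frac_Units_of_basic_open) auto

lemma localization_map_powers:
  assumes "p \<in> carrier G" "r \<in> carrier G" "basic_open G r \<subseteq> basic_open G p"
    and "a \<in> carrier G" "s \<in> powers G p"
  shows "loc_frac G (powers G r) s \<one> \<otimes>\<^bsub>localize_at G r\<^esub>
      localization_map G (powers G p) (powers G r) (loc_frac G (powers G p) a s) =
      loc_frac G (powers G r) a \<one>"
  unfolding localize_at_def
  by (rule localization_map_frac(2)[OF localized_powers[OF assms(1)] localized_powers[OF assms(2)]])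
    (use assms powers_Units in \<open>auto simp: localize_at_def\<close>)

text \<open>The denominator becomes a unit in the target, so the image of a fraction is the only
  solution of the equation with the denominator cleared. Restrictions can thus be identified without
  computing inverses.\<close>

lemma localization_map_eqI:
  assumes p: "p \<in> carrier G" "r \<in> carrier G" "basic_open G r \<subseteq> basic_open G p"
    and a: "a \<in> carrier G" "s \<in> powers G p"
    and x: "x \<in> carrier (localize_at G r)"
      "loc_frac G (powers G r) s \<one> \<otimes>\<^bsub>localize_at G r\<^esub> x = loc_frac G (powers G r) a \<one>"
  shows "localization_map G (powers G p) (powers G r) (loc_frac G (powers G p) a s) = x"
proof (rule comm_monoid_Units_cancel[OF _ powers_Units[OF p a(2)] _ x(1)])
  show "comm_monoid (localize_at G r)"
    unfolding localize_at_def by (rule localized_monoid.comm_monoid_localization[OF localized_powers[OF p(2)]])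
  show "localization_map G (powers G p) (powers G r) (loc_frac G (powers G p) a s) \<in> carrier (localize_at G r)"
    unfolding localize_at_def
    by (rule localization_map_frac(1)[OF localized_powers[OF p(1)] localized_powers[OF p(2)]])
      (use p a powers_Units in \<open>auto simp: localize_at_def\<close>)
qed (use x(2) localization_map_powers[OF p a] in simp)

lemma openin_basic_open: "p \<in> carrier G \<Longrightarrow> openin (Top (Spec G)) (basic_open G p)"
  unfolding Spec_def mspace.simps by (intro topology_generated_by_Basis imageI)

lemma basic_open_one: "basic_open G \<one> = faces G"
  unfolding basic_open_def faces_def using is_face_one by blast

lemma topspace_Spec: "topspace (Top (Spec G)) = faces G"
proof -
  have "\<Union>(basic_open G ` carrier G) = faces G"
    using basic_open_one by (force simp: basic_open_def)
  then show ?thesis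
    by (simp add: Spec_def topology_generated_by_topspace)
qed

text \<open>The topology is defined by generators. That they form a basis comes from
  \<open>basic_open_mult\<close>: a face with \<open>p\<close> and \<open>q\<close> contains
  \<open>p \<otimes> q\<close>, whose basic open set is the intersection of theirs.\<close>

lemma openin_Spec_basis:
  assumes "openin (Top (Spec G)) U" "F \<in> U"
  shows "\<exists>p\<in>F. p \<in> carrier G \<and> basic_open G p \<subseteq> U"
proof -
  have F: "is_face G F"
    using assms openin_subset topspace_Spec unfolding faces_def by blast
  have "generate_topology_on (basic_open G ` carrier G) U"
    using assms(1) by (simp add: Spec_def openin_topology_generated_by_iff)
  then show ?thesis
    using assms(2)
  proof induction
    case (Int U V)
    then obtain p q where "p \<in> F" "p \<in> carrier G" "basic_open G p \<subseteq> U"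
      "q \<in> F" "q \<in> carrier G" "basic_open G q \<subseteq> V"
      by blast
    then show ?case
      using is_face_mult[OF F, of p q] by (intro bexI[of _ "p \<otimes> q"]) (auto simp: basic_open_mult)
  next
    case (UN K)
    then obtain k p where "k \<in> K" "p \<in> F" "p \<in> carrier G" "basic_open G p \<subseteq> k"
      by (metis UnionE)
    then show ?case
      by (intro bexI[of _ p]) auto
  next
    case (Basis B)
    then show ?case
      by (auto simp: basic_open_iff)
  qed simp
qed

section \<open>Sections defined by elements of the monoid\<close>

text \<open>The canonical map from the monoid to the global sections. The families are indexed by
  the whole carrier because every basic open set lies in the spectrum.\<close>

definition Spec_const :: "'p \<Rightarrow> 'p \<Rightarrow> ('p \<times> 'p) set" where
  "Spec_const p = (\<lambda>r\<in>carrier G. loc_frac G (powers G r) p \<one>)"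

lemma basic_index_faces: "basic_index G (faces G) = carrier G"
  by (auto simp: basic_index_def basic_open_def)

lemma Spec_const_closed:
  assumes p: "p \<in> carrier G"
  shows "Spec_const p \<in> carrier (Sec (Spec G) (faces G))"
proof -
  have "loc_frac G (powers G r) p \<one> \<in> carrier (localize_at G r)" if "r \<in> carrier G" for r
    unfolding localize_at_def
    using localized_monoid.frac_closed[OF localized_powers[OF that] p]
      submonoid.one_closed[OF submonoid_powers[OF that]] by blast
  moreover have "localization_map G (powers G r) (powers G q) (loc_frac G (powers G r) p \<one>) =
      loc_frac G (powers G q) p \<one>"
    if rq: "r \<in> carrier G" "q \<in> carrier G" "basic_open G q \<subseteq> basic_open G r" for r q
  proof (rule localization_map_eqI[OF rq p])
    interpret L: localized_monoid G "powers G q"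
      by (rule localized_powers[OF rq(2)])
    show "\<one> \<in> powers G r"
      by (rule submonoid.one_closed[OF submonoid_powers[OF rq(1)]])
    show "L.frac p \<one> \<in> carrier (localize_at G q)"
      using p by (simp add: localize_at_def L.frac_closed)
    show "L.frac \<one> \<one> \<otimes>\<^bsub>localize_at G q\<^esub> L.frac p \<one> = L.frac p \<one>"
      using p by (simp add: localize_at_def L.frac_one_mult)
  qed
  ultimately show ?thesis
    by (simp add: Spec_def Spec_sections_def basic_index_faces Spec_const_def)
qed

lemma Spec_const_mult:
  assumes "p \<in> carrier G" "q \<in> carrier G"
  shows "Spec_const p \<otimes>\<^bsub>Sec (Spec G) (faces G)\<^esub> Spec_const q = Spec_const (p \<otimes> q)"
  using assms
  by (auto simp: Spec_def Spec_sections_def basic_index_faces Spec_const_def localize_at_def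
      localized_monoid.frac_one_mult[OF localized_powers] intro!: restrict_ext)

lemma Spec_const_one: "Spec_const \<one> = \<one>\<^bsub>Sec (Spec G) (faces G)\<^esub>"
  by (auto simp: Spec_def Spec_sections_def basic_index_faces Spec_const_def localize_at_def
      localized_monoid.loc_one[OF localized_powers] intro!: restrict_ext)

text \<open>All localizations indexed by basic open subsets of \<open>basic_open G p\<close> make
  \<open>p\<close> invertible, so inverses exist componentwise. The work is to show that they are
  compatible with the localization maps and form a section.\<close>

lemma Spec_const_inverse:
  assumes p: "p \<in> carrier G"
  shows "\<exists>\<tau>\<in>carrier (Sec (Spec G) (basic_open G p)).
    Res (Spec G) (faces G) (basic_open G p) (Spec_const p)
      \<otimes>\<^bsub>Sec (Spec G) (basic_open G p)\<^esub> \<tau> = \<one>\<^bsub>Sec (Spec G) (basic_open G p)\<^esub>"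
proof -
  let ?I = "basic_index G (basic_open G p)"
  define \<iota> where "\<iota> r = m_inv (localize_at G r) (loc_frac G (powers G r) p \<one>)" for r
  have comm: "comm_monoid (localize_at G r)" if "r \<in> carrier G" for r
    unfolding localize_at_def by (rule localized_monoid.comm_monoid_localization[OF localized_powers[OF that]])
  have I: "r \<in> carrier G" "basic_open G r \<subseteq> basic_open G p" if "r \<in> ?I" for r
    using that by (auto simp: basic_index_def)
  have \<iota>: "\<iota> r \<in> carrier (localize_at G r)"
    "loc_frac G (powers G r) p \<one> \<otimes>\<^bsub>localize_at G r\<^esub> \<iota> r = \<one>\<^bsub>localize_at G r\<^esub>" if "r \<in> ?I" for r
  proof -
    interpret L: comm_monoid "localize_at G r"
      by (rule comm[OF I(1)[OF that]])
    have "loc_frac G (powers G r) p \<one> \<in> Units (localize_at G r)"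
      using I[OF that] p by (intro frac_Units_of_basic_open)
    then show "\<iota> r \<in> carrier (localize_at G r)"
      "loc_frac G (powers G r) p \<one> \<otimes>\<^bsub>localize_at G r\<^esub> \<iota> r = \<one>\<^bsub>localize_at G r\<^esub>"
      unfolding \<iota>_def by simp_all
  qed
  have "\<iota> q = localization_map G (powers G r) (powers G q) (\<iota> r)"
    if r: "r \<in> ?I" and q: "q \<in> carrier G" "basic_open G q \<subseteq> basic_open G r" for r q
  proof -
    have qI: "q \<in> ?I"
      using q I[OF r] by (auto simp: basic_index_def)
    interpret R: localized_monoid G "powers G r"
      by (rule localized_powers[OF I(1)[OF r]])
    interpret Q: localized_monoid G "powers G q"
      by (rule localized_powers[OF q(1)])
    interpret LR: comm_monoid "localize_at G r"
      by (rule comm[OF I(1)[OF r]])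
    interpret LQ: comm_monoid "localize_at G q"
      by (rule comm[OF q(1)])
    \<comment> \<open>As \<open>p\<close> divides a power of \<open>r\<close>, its inverse at
      \<open>r\<close> is an explicit fraction with numerator \<open>a\<close> and denominator
      \<open>p \<otimes> a\<close>, to which \<open>localization_map_eqI\<close> applies.\<close>
    obtain a where a: "a \<in> carrier G" "p \<otimes> a \<in> powers G r"
      using basic_open_subset_dvd[OF I[OF r]] by blast
    have "R.frac p \<one> \<otimes>\<^bsub>localize_at G r\<^esub> R.frac a (p \<otimes> a) = \<one>\<^bsub>localize_at G r\<^esub>"
      using p a unfolding localize_at_def by (simp add: R.frac_mult R.frac_eq_one)
    moreover have "R.frac a (p \<otimes> a) \<in> carrier (localize_at G r)"
      using a R.frac_closed by (simp add: localize_at_def)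
    ultimately have "\<iota> r = R.frac a (p \<otimes> a)"
      by (intro comm_monoid_Units_cancel[OF comm[OF I(1)[OF r]]
          frac_Units_of_basic_open[OF p I[OF r]] \<iota>(1)[OF r]]) (simp_all only: \<iota>(2)[OF r])
    moreover have "localization_map G (powers G r) (powers G q) (R.frac a (p \<otimes> a)) = \<iota> q"
    proof (rule localization_map_eqI[OF I(1)[OF r] q a \<iota>(1)[OF qI]])
      have mem: "Q.frac p \<one> \<in> carrier (localize_at G q)" "Q.frac a \<one> \<in> carrier (localize_at G q)"
        using p a Q.frac_closed by (auto simp: localize_at_def)
      have "Q.frac (p \<otimes> a) \<one> = Q.frac p \<one> \<otimes>\<^bsub>localize_at G q\<^esub> Q.frac a \<one>"
        using p a by (simp add: localize_at_def Q.frac_one_mult)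
      then have "Q.frac (p \<otimes> a) \<one> \<otimes>\<^bsub>localize_at G q\<^esub> \<iota> q =
          Q.frac a \<one> \<otimes>\<^bsub>localize_at G q\<^esub> (Q.frac p \<one> \<otimes>\<^bsub>localize_at G q\<^esub> \<iota> q)"
        using mem \<iota>(1)[OF qI] by (simp add: LQ.m_ac)
      then show "Q.frac (p \<otimes> a) \<one> \<otimes>\<^bsub>localize_at G q\<^esub> \<iota> q = Q.frac a \<one>"
        using mem \<iota>(2)[OF qI] by simp
    qed
    ultimately show ?thesis
      by simp
  qed
  moreover have "q \<in> ?I" if "r \<in> ?I" "q \<in> carrier G" "basic_open G q \<subseteq> basic_open G r" for r q
    using that I[OF that(1)] by (auto simp: basic_index_def)
  ultimately have "restrict \<iota> ?I \<in> carrier (Sec (Spec G) (basic_open G p))"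
    using \<iota>(1) by (simp add: Spec_def Spec_sections_def)
  moreover have "Res (Spec G) (faces G) (basic_open G p) (Spec_const p)
      \<otimes>\<^bsub>Sec (Spec G) (basic_open G p)\<^esub> restrict \<iota> ?I = \<one>\<^bsub>Sec (Spec G) (basic_open G p)\<^esub>"
    using \<iota>(2) I(1) by (auto simp: Spec_def Spec_sections_def Spec_const_def intro!: restrict_ext)
  ultimately show ?thesis
    by blast
qed

text \<open>In the localization at \<open>F\<close> an element is invertible if and only if it
  divides an element of \<open>F\<close>, that is, lies in the face \<open>F\<close>. One component
  of a local inverse suffices to see this, so the stalk is not computed.\<close>

lemma unit_at_Spec_const:
  assumes p: "p \<in> carrier G" and F: "F \<in> faces G"
  shows "unit_at (Spec G) F (faces G) (Spec_const p) \<longleftrightarrow> p \<in> F"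
proof
  have F': "is_face G F"
    using F by (simp only: faces_def mem_Collect_eq)
  {
    assume "p \<in> F"
    then have "F \<in> basic_open G p" "basic_open G p \<subseteq> faces G"
      using F by (auto simp: basic_open_def)
    then show "unit_at (Spec G) F (faces G) (Spec_const p)"
      unfolding unit_at_def using openin_basic_open[OF p] Spec_const_inverse[OF p] by blast
  }
  assume "unit_at (Spec G) F (faces G) (Spec_const p)"
  then obtain W \<tau> where W: "openin (Top (Spec G)) W" "F \<in> W" "\<tau> \<in> carrier (Sec (Spec G) W)"
    "Res (Spec G) (faces G) W (Spec_const p) \<otimes>\<^bsub>Sec (Spec G) W\<^esub> \<tau> = \<one>\<^bsub>Sec (Spec G) W\<^esub>"
    unfolding unit_at_def by blast
  obtain r where r: "r \<in> F" "r \<in> carrier G" "basic_open G r \<subseteq> W"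
    using openin_Spec_basis[OF W(1,2)] by blast
  interpret R: localized_monoid G "powers G r"
    by (rule localized_powers[OF r(2)])
  have rW: "r \<in> basic_index G W"
    using r by (simp add: basic_index_def)
  have "\<tau> r \<in> carrier R.loc"
    using W(3) rW by (auto simp: Spec_def Spec_sections_def localize_at_def)
  then obtain a s where a: "a \<in> carrier G" "s \<in> powers G r" "\<tau> r = R.frac a s"
    by (rule R.loc_cases)
  have "R.frac p \<one> \<otimes>\<^bsub>R.loc\<^esub> \<tau> r = \<one>\<^bsub>R.loc\<^esub>"
    using fun_cong[OF W(4), of r] rW r(2)
    by (simp add: Spec_def Spec_sections_def Spec_const_def localize_at_def)
  then have "R.frac (p \<otimes> a) s = R.frac \<one> \<one>"
    using a p R.denominators.mem_carrier[OF a(2)] by (simp add: R.frac_mult R.loc_one)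
  from R.frac_eqD[OF this] obtain u where u: "u \<in> powers G r" "u \<otimes> (p \<otimes> a \<otimes> \<one>) = u \<otimes> (\<one> \<otimes> s)"
    by auto
  \<comment> \<open>Both \<open>u\<close> and \<open>s\<close> are powers of \<open>r\<close>, hence
    in \<open>F\<close>; so \<open>p\<close> divides an element of \<open>F\<close>.\<close>
  have us: "u \<in> F" "s \<in> F" "u \<in> carrier G" "s \<in> carrier G"
    using u a is_face_pow[OF F' comm_monoid_axioms r(1)] R.denominators.mem_carrier by auto
  then have "u \<otimes> (p \<otimes> a \<otimes> \<one>) \<in> F"
    unfolding u(2) by (simp add: is_face_mult[OF F'])
  then show "p \<in> F"
    using p a(1) us(3) by (simp add: is_face_mult[OF F'])
qed

text \<open>By compatibility the component at \<open>r\<close> determines the section on the basic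
  open set of \<open>r\<close>, and this component is a fraction of \<open>p\<close> by a power
  \<open>q\<close> of \<open>r\<close>. The equation with the denominator cleared is the form that
  morphisms transport directly.\<close>

lemma Spec_section_locally_fraction:
  assumes U: "openin (Top (Spec G)) U" "F \<in> U" and \<tau>: "\<tau> \<in> carrier (Sec (Spec G) U)"
  shows "\<exists>r\<in>F. \<exists>q\<in>F. \<exists>p. r \<in> carrier G \<and> q \<in> carrier G \<and> p \<in> carrier G \<and> basic_open G r \<subseteq> U \<and>
    Res (Spec G) (faces G) (basic_open G r) (Spec_const q) \<otimes>\<^bsub>Sec (Spec G) (basic_open G r)\<^esub>
      Res (Spec G) U (basic_open G r) \<tau> =
    Res (Spec G) (faces G) (basic_open G r) (Spec_const p)"
proof -
  have F: "is_face G F"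
    using U openin_subset topspace_Spec unfolding faces_def by blast
  obtain r where r: "r \<in> F" "r \<in> carrier G" "basic_open G r \<subseteq> U"
    using openin_Spec_basis[OF U] by blast
  interpret R: localized_monoid G "powers G r"
    by (rule localized_powers[OF r(2)])
  have rU: "r \<in> basic_index G U"
    using r by (simp add: basic_index_def)
  have "\<tau> r \<in> carrier R.loc"
    using \<tau> rU by (auto simp: Spec_def Spec_sections_def localize_at_def)
  then obtain p q where p: "p \<in> carrier G" "q \<in> powers G r" "\<tau> r = R.frac p q"
    by (rule R.loc_cases)
  have "loc_frac G (powers G s) q \<one> \<otimes>\<^bsub>localize_at G s\<^esub> \<tau> s = loc_frac G (powers G s) p \<one>"
    if s: "s \<in> basic_index G (basic_open G r)" for s
  proof -
    have s': "s \<in> carrier G" "basic_open G s \<subseteq> basic_open G r"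
      using s by (auto simp: basic_index_def)
    have "\<tau> s = localization_map G (powers G r) (powers G s) (\<tau> r)"
      using \<tau> rU s' by (simp add: Spec_def Spec_sections_def)
    then show ?thesis
      using localization_map_powers[OF r(2) s' p(1,2)] p(3) by simp
  qed
  moreover have "s \<in> carrier G" if "s \<in> basic_index G (basic_open G r)" for s
    using that by (simp add: basic_index_def)
  ultimately have "Res (Spec G) (faces G) (basic_open G r) (Spec_const q) \<otimes>\<^bsub>Sec (Spec G) (basic_open G r)\<^esub>
      Res (Spec G) U (basic_open G r) \<tau> = Res (Spec G) (faces G) (basic_open G r) (Spec_const p)"
    by (auto simp: Spec_def Spec_sections_def Spec_const_def fun_eq_iff restrict_def)
  moreover have "q \<in> F" "q \<in> carrier G"
    using p is_face_pow[OF F comm_monoid_axioms r(1)] R.denominators.mem_carrier by auto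
  ultimately show ?thesis
    using r p(1) by blast
qed

end

section \<open>Fans\<close>

text \<open>A chart \<open>U \<cong> Spec P\<close> in terms of the face \<open>e x\<close> of \<open>P\<close> at \<open>x\<close> and the section \<open>c p\<close> over
  \<open>U\<close> given by \<open>p\<close>.\<close>

locale fan_chart = monoidal_presheaf X for X :: "('x, 'm) mspace" +
  fixes U :: "'x set" and P :: "'p monoid" and e :: "'x \<Rightarrow> 'p set" and c :: "'p \<Rightarrow> 'm"
  assumes P: "comm_monoid P" and opn_U: "opn U"
    and e_face: "x \<in> U \<Longrightarrow> is_face P (e x)"
    and e_surj: "is_face P F \<Longrightarrow> \<exists>x\<in>U. e x = F"
    and e_inj: "inj_on e U"
    and c_hom: "c \<in> monoid_hom P (Sec X U)"
    and unit_at_c: "x \<in> U \<Longrightarrow> p \<in> carrier P \<Longrightarrow> unit_at X x U (c p) \<longleftrightarrow> p \<in> e x"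
    and opn_e: "p \<in> carrier P \<Longrightarrow> opn {x \<in> U. p \<in> e x}"
    and basis: "opn V \<Longrightarrow> x \<in> U \<Longrightarrow> x \<in> V \<Longrightarrow> \<exists>q\<in>e x. {x' \<in> U. q \<in> e x'} \<subseteq> V"
    and fraction: "opn V \<Longrightarrow> V \<subseteq> U \<Longrightarrow> x \<in> V \<Longrightarrow> s \<in> carrier (Sec X V) \<Longrightarrow>
      \<exists>W q p. opn W \<and> x \<in> W \<and> W \<subseteq> V \<and> q \<in> e x \<and> p \<in> carrier P \<and>
        Res X U W (c q) \<otimes>\<^bsub>Sec X W\<^esub> Res X V W s = Res X U W (c p)"
begin

lemmas c_closed = monoid_homD(1)[OF c_hom]
  and c_one = monoid_homD(2)[OF c_hom]
  and c_mult = monoid_homD(3)[OF c_hom]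

text \<open>Generizing a point means enlarging its face. One direction tests the open sets of
  \<open>opn_e\<close>; for the other, \<open>basis\<close> finds such a set inside every
  neighbourhood.\<close>

lemma generizations_iff:
  assumes x: "x \<in> U"
  shows "x' \<in> generizations x \<longleftrightarrow> x' \<in> U \<and> e x \<subseteq> e x'"
proof
  assume x': "x' \<in> generizations x"
  have "p \<in> e x'" if "p \<in> e x" for p
  proof -
    have "x' \<in> {x \<in> U. p \<in> e x}"
      using x' x that opn_e[OF is_face_closed[OF e_face[OF x] that]] by (auto simp: generizations_def)
    then show ?thesis
      by simp
  qed
  moreover have "x' \<in> U"
    using x' x opn_U by (simp add: generizations_def)
  ultimately show "x' \<in> U \<and> e x \<subseteq> e x'"
    by blast
next
  assume "x' \<in> U \<and> e x \<subseteq> e x'"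
  then show "x' \<in> generizations x"
    using basis[OF _ x] unfolding generizations_def by blast
qed

lemma germ_c_unit_face_iff:
  assumes "x \<in> U" "x' \<in> generizations x" "p \<in> carrier P"
  shows "germ X x U (c p) \<in> unit_face x x' \<longleftrightarrow> p \<in> e x'"
  using assms generizations_iff[OF assms(1)]
  by (simp add: germ_unit_face_iff opn_U c_closed unit_at_c)

text \<open>Testing the face of the stalk on germs of the sections \<open>c p\<close> recovers the
  face of \<open>P\<close> at the generization, and \<open>e\<close> is injective.\<close>

lemma unit_face_inj:
  assumes x: "x \<in> U" and x': "x' \<in> generizations x" "x'' \<in> generizations x"
    and eq: "unit_face x x' = unit_face x x''"
  shows "x' = x''"
proof -
  have U: "x' \<in> U" "x'' \<in> U"
    using generizations_iff[OF x] x' by auto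
  have "p \<in> e x' \<longleftrightarrow> p \<in> e x''" if "p \<in> carrier P" for p
    using germ_c_unit_face_iff[OF x x'(1) that] germ_c_unit_face_iff[OF x x'(2) that] eq by simp
  then have "e x' = e x''"
    using is_face_closed[OF e_face[OF U(1)]] is_face_closed[OF e_face[OF U(2)]] by blast
  then show ?thesis
    using e_inj U by (simp add: inj_on_eq_iff)
qed

text \<open>The preimage \<open>F'\<close> of \<open>F\<close> in \<open>P\<close> contains
  \<open>e x\<close>, because elements of \<open>e x\<close> have invertible germs. So it is the
  face at a generization \<open>x'\<close>, and it remains to compare \<open>F\<close> with
  \<open>unit_face x x'\<close> on germs that do not come from \<open>P\<close>.\<close>

lemma unit_face_surj:
  assumes x: "x \<in> U" and F: "is_face (stalk X x) F"
  shows "\<exists>x'\<in>generizations x. unit_face x x' = F"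
proof -
  have xX: "x \<in> topspace (Top X)"
    using x opn_U openin_subset by blast
  have germ_c: "germ X x U (c p) \<in> carrier (stalk X x)" if "p \<in> carrier P" for p
    using opn_U x c_closed[OF that] by (rule germ_closed)
  have germ_c_unit: "germ X x U (c p) \<in> Units (stalk X x)" if "p \<in> e x" for p
    using germ_Units_iff[OF opn_U x c_closed] unit_at_c[OF x] is_face_closed[OF e_face[OF x] that] that
    by simp
  define F' where "F' = {p \<in> carrier P. germ X x U (c p) \<in> F}"
  have "is_face P F'"
  proof (rule is_faceI)
    interpret P: comm_monoid P by (rule P)
    show "F' \<subseteq> carrier P"
      by (auto simp: F'_def)
    show "\<one>\<^bsub>P\<^esub> \<in> F'"
      using is_face_one[OF F] by (simp add: F'_def c_one stalk_one[OF opn_U x])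
    fix p q assume pq: "p \<in> carrier P" "q \<in> carrier P"
    have "germ X x U (c (p \<otimes>\<^bsub>P\<^esub> q)) = germ X x U (c p) \<otimes>\<^bsub>stalk X x\<^esub> germ X x U (c q)"
      using pq by (simp add: c_mult stalk_mult opn_U x c_closed)
    then show "p \<otimes>\<^bsub>P\<^esub> q \<in> F' \<longleftrightarrow> p \<in> F' \<and> q \<in> F'"
      using pq by (simp add: F'_def is_face_mult[OF F] germ_c)
  qed
  then obtain x' where x': "x' \<in> U" "e x' = F'"
    using e_surj by blast
  have "e x \<subseteq> F'"
    using germ_c_unit is_face_Units[OF F] is_face_closed[OF e_face[OF x]] by (auto simp: F'_def)
  then have gen: "x' \<in> generizations x"
    using x' generizations_iff[OF x] by simp
  have c_iff: "germ X x U (c p) \<in> unit_face x x' \<longleftrightarrow> germ X x U (c p) \<in> F" if "p \<in> carrier P" for p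
    using germ_c_unit_face_iff[OF x gen that] that unfolding x'(2) F'_def by simp
  have "a \<in> unit_face x x' \<longleftrightarrow> a \<in> F" if a: "a \<in> carrier (stalk X x)" for a
  proof -
    obtain V s where V: "opn V" "x \<in> V" "s \<in> carrier (Sec X V)" "a = germ X x V s"
      by (rule stalk_cases[OF a])
    define s' where "s' = Res X V (V \<inter> U) s"
    have V': "opn (V \<inter> U)" "V \<inter> U \<subseteq> U" "x \<in> V \<inter> U" "s' \<in> carrier (Sec X (V \<inter> U))"
      unfolding s'_def using V opn_U x by (auto intro!: Res_closed)
    have a': "a = germ X x (V \<inter> U) s'"
      unfolding s'_def V(4) using V V' by (intro germ_Res[symmetric]) auto
    obtain W q p where W: "opn W" "x \<in> W" "W \<subseteq> V \<inter> U" "q \<in> e x" "p \<in> carrier P"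
      "Res X U W (c q) \<otimes>\<^bsub>Sec X W\<^esub> Res X (V \<inter> U) W s' = Res X U W (c p)"
      using fraction[OF V'] by blast
    have q: "q \<in> carrier P"
      using is_face_closed[OF e_face[OF x] W(4)] .
    have WU: "W \<subseteq> U"
      using W(3) by blast
    have "germ X x U (c q) \<otimes>\<^bsub>stalk X x\<^esub> a =
        germ X x W (Res X U W (c q)) \<otimes>\<^bsub>stalk X x\<^esub> germ X x W (Res X (V \<inter> U) W s')"
      unfolding a' using W(1-3) WU V'(1,4) q by (simp add: germ_Res opn_U c_closed)
    also have "\<dots> = germ X x W (Res X U W (c p))"
      unfolding W(6)[symmetric] using W(1-3) WU V'(1,4) q
      by (intro stalk_mult) (auto intro!: Res_closed c_closed opn_U)
    also have "\<dots> = germ X x U (c p)"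
      using W(1,2,5) WU by (intro germ_Res) (auto intro!: c_closed opn_U)
    finally have eq: "germ X x U (c q) \<otimes>\<^bsub>stalk X x\<^esub> a = germ X x U (c p)" .
    \<comment> \<open>The germ of \<open>c q\<close> is a unit, hence in every face, so a face
      contains \<open>a\<close> exactly when it contains the germ of \<open>c p\<close>. Faces that
      agree on germs from \<open>P\<close> therefore agree.\<close>
    have "a \<in> H \<longleftrightarrow> germ X x U (c p) \<in> H" if "is_face (stalk X x) H" for H
      using is_face_mult[OF that germ_c[OF q] a] is_face_Units[OF that germ_c_unit[OF W(4)]] eq by simp
    then show ?thesis
      using c_iff[OF W(5)] F is_face_unit_face[OF xX gen] by simp
  qed
  then have "unit_face x x' = F"
    using is_face_closed[OF F] is_face_closed[OF is_face_unit_face[OF xX gen]] by blast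
  then show ?thesis
    using gen by blast
qed

text \<open>A face contains \<open>e x\<close> as soon as it contains the generators in
  \<open>e x\<close>. So the generizations are cut out of \<open>U\<close> by finitely many of the
  open conditions in \<open>opn_e\<close>.\<close>

lemma opn_generizations:
  assumes x: "x \<in> U" and fg: "finitely_generated_monoid P"
  shows "opn (generizations x)"
proof -
  interpret P: comm_monoid P by (rule P)
  obtain A where A: "finite A" "A \<subseteq> carrier P"
    and gen: "\<Inter>{H. submonoid H P \<and> A \<subseteq> H} = carrier P"
    using fg by (auto simp: finitely_generated_monoid_def)
  have sub: "e x \<subseteq> F" if F: "is_face P F" and AF: "A \<inter> e x \<subseteq> F" for F
  proof -
    \<comment> \<open>The elements that respect the inclusion. They are closed under products
      because a product in the face \<open>e x\<close> has both factors in \<open>e x\<close>; so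
      they include everything that \<open>A\<close> generates.\<close>
    let ?H = "{p \<in> carrier P. p \<in> e x \<longrightarrow> p \<in> F}"
    have "submonoid ?H P"
    proof (rule submonoid.intro)
      show "\<one>\<^bsub>P\<^esub> \<in> ?H"
        using is_face_one[OF F] by simp
      fix p q assume "p \<in> ?H" "q \<in> ?H"
      then show "p \<otimes>\<^bsub>P\<^esub> q \<in> ?H"
        using is_face_mult[OF F, of p q] is_face_mult[OF e_face[OF x], of p q] by auto
    qed auto
    moreover have "A \<subseteq> ?H"
      using A(2) AF by blast
    ultimately have "carrier P \<subseteq> ?H"
      unfolding gen[symmetric] by (intro Inter_lower) simp
    then show ?thesis
      using is_face_closed[OF e_face[OF x]] by blast
  qed
  have "x' \<in> generizations x \<longleftrightarrow> x' \<in> U \<and> A \<inter> e x \<subseteq> e x'" for x'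
    unfolding generizations_iff[OF x] using sub[OF e_face] by blast
  \<comment> \<open>The intersection with the whole space matters when \<open>A \<inter> e x\<close>
    is empty, since the intersection over an empty index set is \<open>UNIV\<close>.\<close>
  then have "generizations x = U \<inter> ((\<Inter>a\<in>A \<inter> e x. {x' \<in> U. a \<in> e x'}) \<inter> topspace (Top X))"
    using openin_subset[OF opn_U] by auto
  moreover have "opn ((\<Inter>a\<in>A \<inter> e x. {x' \<in> U. a \<in> e x'}) \<inter> topspace (Top X))"
    using A by (intro openin_INT) (auto intro!: opn_e)
  ultimately show ?thesis
    using opn_U by (simp add: openin_Int)
qed

end

section \<open>Charts from isomorphisms with a spectrum\<close>

text \<open>The map \<open>f\<close> of the isomorphism serves as \<open>e\<close>, and
  \<open>c p\<close> is the image under \<open>\<phi>\<close> of the global section given by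
  \<open>p\<close>; each condition on a chart is a fact about the spectrum, transported.
  Invertibility passes between the subspace and \<open>X\<close> by
  \<open>unit_at_open_subspace\<close>, which avoids a comparison of stalks.\<close>

lemma fan_chart_exists:
  fixes P :: "'p monoid"
  assumes X: "locally_monoidal_space X" and U: "openin (Top X) U" and P: "comm_monoid P"
    and iso: "mspace_isomorphic (open_subspace X U) (Spec P)"
  shows "\<exists>e c. fan_chart X U P e c"
proof -
  interpret monoidal_presheaf X
    by (rule locally_monoidal_presheaf[OF X])
  interpret P: spectrum P
    by (simp add: spectrum_def P)
  define X' where "X' = open_subspace X U"
  have X'[simp]: "Sec X' = Sec X" "Res X' = Res X" "topspace (Top X') = U"
    using openin_subset[OF U] by (auto simp: X'_def open_subspace_def)
  have opn': "openin (Top X') V \<longleftrightarrow> opn V \<and> V \<subseteq> U" for V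
    by (simp add: X'_def open_subspace_def openin_open_subtopology[OF U])
  obtain f \<phi> g \<psi> where f: "mspace_morphism X' (Spec P) f \<phi>" and g: "mspace_morphism (Spec P) X' g \<psi>"
    and gf: "\<forall>x\<in>topspace (Top X'). g (f x) = x"
    and fg: "\<forall>F\<in>topspace (Top (Spec P)). f (g F) = F"
    and \<phi>\<psi>: "\<forall>V. openin (Top X') V \<longrightarrow> (\<forall>s\<in>carrier (Sec X' V). \<phi> (preim (Spec P) g V) (\<psi> V s) = s)"
    using iso unfolding mspace_isomorphic_def X'_def[symmetric] by (elim exE conjE)
  interpret S: monoidal_presheaf "Spec P"
    by (rule mspace_morphismD(2)[OF f])
  note \<phi>_hom = monoid_homD[OF mspace_morphismD(4)[OF f]]
  have f_face: "f x \<in> faces P" if "x \<in> U" for x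
    using mspace_morphismD(3)[OF f] that by (auto simp: continuous_map_def P.topspace_Spec)
  have g_U: "g F \<in> U" if "F \<in> faces P" for F
    using mspace_morphismD(3)[OF g] that by (auto simp: continuous_map_def P.topspace_Spec)
  have opn_faces: "S.opn (faces P)"
    using openin_topspace[of "Top (Spec P)"] by (simp add: P.topspace_Spec)
  have preim_faces: "preim X' f (faces P) = U"
    using f_face by (auto simp: preim_def)
  define c where "c p = \<phi> (faces P) (P.Spec_const p)" for p
  have c_hom: "c \<in> monoid_hom P (Sec X U)"
    using \<phi>_hom[OF opn_faces] P.Spec_const_closed
    by (auto simp: monoid_hom_def hom_def c_def preim_faces P.Spec_const_mult[symmetric] P.Spec_const_one)
  have "fan_chart X U P f c"
  proof unfold_locales
    show "opn U" "c \<in> monoid_hom P (Sec X U)"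
      by fact+
    show "is_face P (f x)" if "x \<in> U" for x
      using f_face[OF that] by (simp only: faces_def mem_Collect_eq)
    show "\<exists>x\<in>U. f x = F" if "is_face P F" for F
    proof -
      have "F \<in> faces P"
        using that by (simp only: faces_def mem_Collect_eq)
      then show ?thesis
        using g_U fg P.topspace_Spec by blast
    qed
    show "inj_on f U"
      using gf by (intro inj_on_inverseI[of _ g]) simp
    show "unit_at X x U (c p) \<longleftrightarrow> p \<in> f x" if "x \<in> U" "p \<in> carrier P" for x p
    proof -
      have "unit_at X x U (c p) \<longleftrightarrow> unit_at X' x U (c p)"
        using unit_at_open_subspace[OF U subset_refl] by (simp add: X'_def)
      also have "\<dots> \<longleftrightarrow> unit_at (Spec P) (f x) (faces P) (P.Spec_const p)"
        using unit_at_morphism[OF f _ opn_faces f_face[OF that(1)] P.Spec_const_closed[OF that(2)]] that(1)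
        by (simp add: c_def preim_faces)
      also have "\<dots> \<longleftrightarrow> p \<in> f x"
        by (rule P.unit_at_Spec_const[OF that(2) f_face[OF that(1)]])
      finally show ?thesis .
    qed
    show "opn {x \<in> U. p \<in> f x}" if "p \<in> carrier P" for p
    proof -
      have "preim X' f (basic_open P p) = {x \<in> U. p \<in> f x}"
        using f_face by (auto simp: preim_def basic_open_def)
      then show ?thesis
        using mspace_morphism_preim[OF f P.openin_basic_open[OF that]] opn' by simp
    qed
    show "\<exists>q\<in>f x. {x' \<in> U. q \<in> f x'} \<subseteq> V" if "opn V" "x \<in> U" "x \<in> V" for V x
    proof -
      have "openin (Top X') (V \<inter> U)"
        using that U by (auto simp: opn')
      moreover have "f x \<in> preim (Spec P) g (V \<inter> U)"
        using that f_face gf by (simp add: preim_def P.topspace_Spec)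
      ultimately obtain q where q: "q \<in> f x" "basic_open P q \<subseteq> preim (Spec P) g (V \<inter> U)"
        using P.openin_Spec_basis[OF mspace_morphism_preim[OF g]] by blast
      have "x' \<in> V" if x': "x' \<in> U" "q \<in> f x'" for x'
      proof -
        have "f x' \<in> basic_open P q"
          using x' f_face by (simp add: basic_open_def)
        then have "g (f x') \<in> V"
          using q(2) by (auto simp: preim_def)
        then show ?thesis
          using gf x'(1) by simp
      qed
      then show ?thesis
        using q(1) by blast
    qed
    show "\<exists>W q p. opn W \<and> x \<in> W \<and> W \<subseteq> V \<and> q \<in> f x \<and> p \<in> carrier P \<and>
        Res X U W (c q) \<otimes>\<^bsub>Sec X W\<^esub> Res X V W s = Res X U W (c p)"
      if V: "opn V" "V \<subseteq> U" "x \<in> V" "s \<in> carrier (Sec X V)" for V x s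
    proof -
      define V' where "V' = preim (Spec P) g V"
      have V'': "openin (Top X') V"
        using V opn' by simp
      have V': "S.opn V'" "f x \<in> V'"
        unfolding V'_def using mspace_morphism_preim[OF g V''] V f_face gf
        by (auto simp: preim_def P.topspace_Spec)
      have \<psi>s: "\<psi> V s \<in> carrier (Sec (Spec P) V')"
        using monoid_homD(1)[OF mspace_morphismD(4)[OF g V'']] V(4) by (simp add: V'_def)
      have \<phi>\<psi>s: "\<phi> V' (\<psi> V s) = s"
        using \<phi>\<psi> V'' V(4) by (simp add: V'_def)
      have preim_V': "preim X' f V' = V"
        unfolding V'_def using V(2) f_face gf by (auto simp: preim_def P.topspace_Spec subset_eq)
      obtain r q p where r: "r \<in> f x" "r \<in> carrier P" and q: "q \<in> f x" "q \<in> carrier P"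
        and p: "p \<in> carrier P" and B: "basic_open P r \<subseteq> V'"
        and eq: "Res (Spec P) (faces P) (basic_open P r) (P.Spec_const q) \<otimes>\<^bsub>Sec (Spec P) (basic_open P r)\<^esub>
          Res (Spec P) V' (basic_open P r) (\<psi> V s) =
          Res (Spec P) (faces P) (basic_open P r) (P.Spec_const p)"
        using P.Spec_section_locally_fraction[OF V' \<psi>s] by blast
      define B where "B = basic_open P r"
      have opn_B: "S.opn B" and B: "B \<subseteq> V'" "B \<subseteq> faces P"
        using P.openin_basic_open[OF r(2)] B by (auto simp: B_def basic_open_def)
      define W where "W = preim X' f B"
      have "W \<subseteq> preim X' f V'"
        using B(1) by (auto simp: W_def preim_def)
      then have "W \<subseteq> V"
        unfolding preim_V' .
      moreover have "x \<in> U" "f x \<in> B"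
        using V(2,3) f_face r(1) by (auto simp: B_def basic_open_def)
      ultimately have W: "opn W" "x \<in> W" "W \<subseteq> V"
        using mspace_morphism_preim[OF f opn_B] opn'[of W] by (simp_all add: W_def preim_def)
      \<comment> \<open>Since \<open>\<phi>\<close> commutes with restriction, the fraction equation
        over \<open>B\<close> becomes one over its preimage \<open>W\<close>.\<close>
      have const: "\<phi> B (Res (Spec P) (faces P) B (P.Spec_const a)) = Res X U W (c a)"
        if "a \<in> carrier P" for a
        using mspace_morphismD(5)[OF f opn_faces opn_B B(2) P.Spec_const_closed[OF that]]
        by (simp add: preim_faces W_def c_def)
      have "Res X V W s = \<phi> B (Res (Spec P) V' B (\<psi> V s))"
        using mspace_morphismD(5)[OF f V'(1) opn_B B(1) \<psi>s] by (simp add: preim_V' W_def \<phi>\<psi>s)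
      then have "Res X U W (c q) \<otimes>\<^bsub>Sec X W\<^esub> Res X V W s =
          \<phi> B (Res (Spec P) (faces P) B (P.Spec_const q) \<otimes>\<^bsub>Sec (Spec P) B\<^esub> Res (Spec P) V' B (\<psi> V s))"
        using \<phi>_hom(3)[OF opn_B S.Res_closed[OF opn_faces opn_B B(2) P.Spec_const_closed[OF q(2)]]
            S.Res_closed[OF V'(1) opn_B B(1) \<psi>s]]
        by (simp add: const[OF q(2)] W_def)
      also have "\<dots> = Res X U W (c p)"
        using eq const[OF p] by (simp add: B_def)
      finally show ?thesis
        using W q p by blast
    qed
  qed
  then show ?thesis
    by blast
qed

section \<open>Lifting of generizations, and openness\<close>

text \<open>The analogue of going down for flat ring maps. The lifted face \<open>F\<close> is
  realized by a point \<open>x'\<close> through \<open>X.unit_face_surj\<close>, and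
  \<open>Y.unit_face_inj\<close> identifies \<open>f x'\<close> with \<open>y'\<close> once their
  faces are seen to agree.\<close>

lemma flat_map_lift_generization:
  fixes X :: "('x, 'm) mspace" and Y :: "('y, 'n) mspace"
  assumes X: "fan X" and Y: "fan Y" and f: "flat_map TI TA TC X Y f \<phi>"
    and x: "x \<in> topspace (Top X)" and y': "y' \<in> monoidal_presheaf.generizations Y (f x)"
  shows "\<exists>x'\<in>monoidal_presheaf.generizations X x. f x' = y'"
proof -
  have mor: "mspace_morphism X Y f \<phi>"
    and flat: "flat_hom TI TA TC (stalk Y (f x)) (stalk X x) (stalk_map X f \<phi> x)"
    using f x by (auto simp: flat_map_def)
  have y: "f x \<in> topspace (Top Y)"
    using mspace_morphismD(3)[OF mor] x by (auto simp: continuous_map_def)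
  obtain U P where U: "openin (Top X) U" "x \<in> U" "comm_monoid (P :: 'm monoid)"
    "mspace_isomorphic (open_subspace X U) (Spec P)"
    using X x unfolding fan_def by blast
  obtain V Q where V: "openin (Top Y) V" "f x \<in> V" "comm_monoid (Q :: 'n monoid)"
    "mspace_isomorphic (open_subspace Y V) (Spec Q)"
    using Y y unfolding fan_def by blast
  obtain e c where "fan_chart X U P e c"
    using fan_chart_exists[OF _ U(1,3,4)] X by (auto simp: fan_def)
  then interpret X: fan_chart X U P e c .
  obtain e' c' where "fan_chart Y V Q e' c'"
    using fan_chart_exists[OF _ V(1,3,4)] Y by (auto simp: fan_def)
  then interpret Y: fan_chart Y V Q e' c' .
  obtain F where F: "is_face (stalk X x) F"
    and FG: "\<forall>a\<in>carrier (stalk Y (f x)). stalk_map X f \<phi> x a \<in> F \<longleftrightarrow> a \<in> Y.unit_face (f x) y'"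
    using flat_local_hom_lift_face[OF Y.comm_monoid_stalk[OF y] X.comm_monoid_stalk[OF x] flat
        mspace_morphismD(6)[OF mor x] Y.is_face_unit_face[OF y y']] by blast
  obtain x' where x': "x' \<in> X.generizations x" and xF: "X.unit_face x x' = F"
    using X.unit_face_surj[OF U(2) F] by blast
  have x'X: "x' \<in> topspace (Top X)"
    using x' x by (simp add: X.generizations_def)
  have fx': "f x' \<in> Y.generizations (f x)"
  proof -
    have "f x' \<in> W" if W: "Y.opn W" "f x \<in> W" for W
    proof -
      have "x \<in> preim X f W"
        using x W(2) by (simp add: preim_def)
      then have "x' \<in> preim X f W"
        using mspace_morphism_preim[OF mor W(1)] x' by (simp add: X.generizations_def)
      then show ?thesis
        by (simp add: preim_def)
    qed
    then show ?thesis
      by (simp add: Y.generizations_def)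
  qed
  have "a \<in> Y.unit_face (f x) (f x') \<longleftrightarrow> a \<in> Y.unit_face (f x) y'"
    if a: "a \<in> carrier (stalk Y (f x))" for a
  proof -
    obtain W t where W: "Y.opn W" "f x \<in> W" "t \<in> carrier (Sec Y W)" "a = germ Y (f x) W t"
      by (rule Y.stalk_cases[OF a])
    have fW: "f x' \<in> W"
      using fx' W by (simp add: Y.generizations_def)
    have xW: "x \<in> preim X f W"
      using x W by (simp add: preim_def)
    have "a \<in> Y.unit_face (f x) (f x') \<longleftrightarrow> unit_at Y (f x') W t"
      unfolding W(4) by (rule Y.germ_unit_face_iff[OF fx' W(1-3)])
    \<comment> \<open>Locality is used here at the lifted point \<open>x'\<close>, whereas the
      lifting of the face used it at \<open>x\<close>.\<close>
    also have "\<dots> \<longleftrightarrow> unit_at X x' (preim X f W) (\<phi> W t)"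
      by (rule unit_at_morphism[OF mor x'X W(1) fW W(3), symmetric])
    also have "\<dots> \<longleftrightarrow> germ X x (preim X f W) (\<phi> W t) \<in> X.unit_face x x'"
      by (rule X.germ_unit_face_iff[OF x' mspace_morphism_preim[OF mor W(1)] xW
            monoid_homD(1)[OF mspace_morphismD(4)[OF mor W(1)] W(3)], symmetric])
    also have "germ X x (preim X f W) (\<phi> W t) = stalk_map X f \<phi> x a"
      unfolding W(4) by (rule stalk_map_germ[OF mor x W(1-3), symmetric])
    also have "\<dots> \<in> X.unit_face x x' \<longleftrightarrow> a \<in> Y.unit_face (f x) y'"
      unfolding xF using FG a by blast
    finally show ?thesis .
  qed
  then have "Y.unit_face (f x) (f x') = Y.unit_face (f x) y'"
    using is_face_closed[OF Y.is_face_unit_face[OF y fx']] is_face_closed[OF Y.is_face_unit_face[OF y y']]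
    by blast
  then have "f x' = y'"
    by (rule Y.unit_face_inj[OF V(2) fx' y'])
  then show ?thesis
    using x' by blast
qed

lemma locally_finite_type_fan_openin_generizations:
  fixes Y :: "('y, 'n) mspace"
  assumes Y: "locally_finite_type_fan Y" and y: "y \<in> topspace (Top Y)"
  shows "openin (Top Y) (monoidal_presheaf.generizations Y y)"
proof -
  obtain V Q where V: "openin (Top Y) V" "y \<in> V" "comm_monoid (Q :: 'n monoid)"
    "finitely_generated_monoid Q" "mspace_isomorphic (open_subspace Y V) (Spec Q)"
    using Y y unfolding locally_finite_type_fan_def by (metis UnionE)
  obtain e c where "fan_chart Y V Q e c"
    using fan_chart_exists[OF _ V(1,3,5)] Y by (auto simp: fan_def locally_finite_type_fan_def)
  then interpret fan_chart Y V Q e c .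
  show ?thesis
    by (rule opn_generizations[OF V(2,4)])
qed

text \<open>The open neighbourhood of \<open>f x\<close> inside the image is the set of all its
  generizations: each lifts to a generization of \<open>x\<close>, which stays in the open set
  \<open>T\<close>.\<close>

lemma flat_map_open_map:
  assumes X: "fan X" and Y: "locally_finite_type_fan Y" and f: "flat_map TI TA TC X Y f \<phi>"
  shows "open_map (Top X) (Top Y) f"
  unfolding open_map_def
proof (intro allI impI)
  fix T assume T: "openin (Top X) T"
  have mor: "mspace_morphism X Y f \<phi>"
    using f by (simp add: flat_map_def)
  interpret X: monoidal_presheaf X by (rule mspace_morphismD(1)[OF mor])
  interpret Y: monoidal_presheaf Y by (rule mspace_morphismD(2)[OF mor])
  have Y': "fan Y"
    using Y by (simp add: locally_finite_type_fan_def)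
  have "\<exists>V. Y.opn V \<and> f x \<in> V \<and> V \<subseteq> f ` T" if "x \<in> T" for x
  proof (intro exI conjI)
    have x: "x \<in> topspace (Top X)"
      using T that openin_subset by blast
    then have "f x \<in> topspace (Top Y)"
      using mspace_morphismD(3)[OF mor] by (auto simp: continuous_map_def)
    then show "Y.opn (Y.generizations (f x))"
      by (rule locally_finite_type_fan_openin_generizations[OF Y])
    show "f x \<in> Y.generizations (f x)"
      by (simp add: Y.generizations_def)
    show "Y.generizations (f x) \<subseteq> f ` T"
    proof
      fix y' assume "y' \<in> Y.generizations (f x)"
      then obtain x' where "x' \<in> X.generizations x" "f x' = y'"
        using flat_map_lift_generization[OF X Y' f x] by blast
      then show "y' \<in> f ` T"
        using T that by (auto simp: X.generizations_def)
    qed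
  qed
  then show "openin (Top Y) (f ` T)"
    by (subst openin_subopen) blast
qed

theorem corollary4p9p8:
  fixes X :: "('x, 'm) mspace" and Y :: "('y, 'n) mspace"
    and f :: "'x \<Rightarrow> 'y" and \<phi> :: "'y set \<Rightarrow> 'n \<Rightarrow> 'm"
  assumes "locally_finite_type_fan X" and "locally_finite_type_fan Y"
  shows "(flat_map TYPE('i) TYPE('a) TYPE('c) X Y f \<phi> \<longrightarrow> open_map (Top X) (Top Y) f) \<and>
    (flat_cover TYPE('i) TYPE('a) TYPE('c) X Y f \<phi> \<longrightarrow>
       open_map (Top X) (Top Y) f \<and> f ` topspace (Top X) = topspace (Top Y))"
proof -
  have "fan X"
    using assms(1) by (simp add: locally_finite_type_fan_def)
  then show ?thesis
    using flat_map_open_map assms(2) by (auto simp only: flat_cover_def)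
qed

end
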